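(* Let $\mathbb{F}$ be a finite field. For every $k,m,r\in\mathbb{N}$ there is $n\in\mathbb{N}$ such that for every map $c:M_{n,n}^k(\mathbb{F})\to\{0,1,\dots,r-1\}$ there are $R_0,R_1\in\mathcal{E}_{n,m}(\mathbb{F})$ such that $\tau^{(2)}$ is a factor of $c$ in $R_0\cdot M_{m,m}^k(\mathbb{F})\cdot R_1^{\mathrm{t}}=\{R_0\cdot A\cdot R_1^{\mathrm t}: A\in M_{m,m}^k(\mathbb{F})\}$; that is, there is $\widetilde c:\mathrm{GL}(\mathbb{F}^k)\to\{0,1,\dots,r-1\}$ such that $c(B)=\widetilde c(\tau^{(2)}(B))$ for every $B\in R_0\cdot M_{m,m}^k(\mathbb{F})\cdot R_1^{\mathrm t}$.
   Context: $M_{n,m}^k(\mathbb{F})$ is the set of $n\times m$ matrices of rank $k$ over $\mathbb{F}$; ${}^{\mathrm t}$ denotes transpose. Rows and columns are indexed from $0$ and $u_i$ denotes the $i$-th unit vector; $\langle\cdot\rangle$ denotes linear span. A $p\times q$ matrix $A$ of rank $p_0$ is in reduced row echelon form (RREF) if there is a strictly increasing sequence $(j_i)_{i<p_0}$ of integers $<q$ such that $A\cdot u_{j_i}=u_i$ and $\langle A\cdot u_j\rangle_{j<j_i}=\langle u_l\rangle_{l<i}$ for every $i<p_0$. A matrix is in reduced column echelon form (RCEF) if its transpose is in RREF. $\mathcal{E}_{n,m}(\mathbb{F})$ is the set of $n\times m$ matrices of rank $m$ over $\mathbb{F}$ in RCEF. The map $\tau^{(2)}:M_{n,n}^k(\mathbb{F})\to\mathrm{GL}(\mathbb{F}^k)$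 is the (well-defined) map uniquely determined by the relation $A=A_0\cdot\tau^{(2)}(A)\cdot A_1^{\mathrm t}$ for some $A_0,A_1\in\mathcal{E}_{n,k}(\mathbb{F})$. *)

theory Defs
  imports "Jordan_Normal_Form.DL_Rank"
begin

definition mats_of_rank :: "nat \<Rightarrow> nat \<Rightarrow> nat \<Rightarrow> 'a::field mat set" where
  "mats_of_rank n m k = {A \<in> carrier_mat n m. vec_space.rank n A = k}"

definition GL :: "nat \<Rightarrow> 'a::field mat set" where
  "GL k = {T \<in> carrier_mat k k. invertible_mat T}"

abbreviation span_vec :: "nat \<Rightarrow> 'a::field vec set \<Rightarrow> 'a vec set" where
  "span_vec p S \<equiv> LinearCombinations.module.span class_ring (module_vec TYPE('a) p) S"

definition rref :: "'a::field mat \<Rightarrow> bool" where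
  "rref A \<longleftrightarrow>
     (let p = dim_row A; q = dim_col A; p0 = vec_space.rank p A in
      \<exists>j :: nat \<Rightarrow> nat. strict_mono_on {..<p0} j \<and>
        (\<forall>i<p0. j i < q \<and>
           A *\<^sub>v unit_vec q (j i) = unit_vec p i \<and>
           span_vec p {A *\<^sub>v unit_vec q l | l. l < j i} = span_vec p {unit_vec p l | l. l < i}))"

definition rcef :: "'a::field mat \<Rightarrow> bool" where
  "rcef A \<longleftrightarrow> rref (transpose_mat A)"

definition rcef_mats :: "nat \<Rightarrow> nat \<Rightarrow> 'a::field mat set" where
  "rcef_mats n m = {A \<in> mats_of_rank n m m. rcef A}"

(* Meaningful on mats_of_rank n n k, where every matrix A has exactly one such T:
   A0 and A1 are the reduced column echelon bases of the column space of A and of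
   the column space of its transpose. *)
definition tau2 :: "nat \<Rightarrow> nat \<Rightarrow> 'a::field mat \<Rightarrow> 'a mat" where
  "tau2 n k A = (THE T. T \<in> GL k \<and>
     (\<exists>A0 \<in> rcef_mats n k. \<exists>A1 \<in> rcef_mats n k. A = A0 * T * transpose_mat A1))"

end

theory Submission
  imports Defs
begin

text \<open>
  A matrix of rank \<open>k\<close> has a unique factorisation \<open>A = A0 * T * A1\<^sup>T\<close> with \<open>A0\<close>, \<open>A1\<close> of full rank in
  reduced column echelon form (RCEF) and \<open>T\<close> invertible, and the product of two RCEF matrices of
  full column rank is again one. Hence multiplying \<open>A\<close> by \<open>R0\<close> on the left and by \<open>R1\<^sup>T\<close> on the right
  replaces \<open>A0\<close>, \<open>A1\<close> by \<open>R0 * A0\<close>, \<open>R1 * A1\<close> and leaves the invariant \<open>T\<close> alone. Give a pair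
  \<open>(A0, A1)\<close> the colour \<open>T \<mapsto> c (A0 * T * A1\<^sup>T)\<close>; over a finite field there are finitely many such
  functions. The theorem says exactly that \<open>R0\<close> and \<open>R1\<close> can be chosen so that all pairs
  \<open>(R0 * A0, R1 * A1)\<close> get the same colour. This is a two-fold product of the statement for
  single RCEF matrices, and the product follows by applying the single statement twice, first with
  colours that are functions of the other coordinate.

  Since a \<open>k\<close>-dimensional subspace of \<open>F\<^sup>n\<close> has exactly one RCEF basis matrix, the single statement
  is the theorem of Graham, Leeb and Rothschild on colourings of the \<open>k\<close>-dimensional subspaces of a
  finite vector space. It is proved by the induction that is usual for the Graham--Rothschild theorem on
  parameter words. Read from top to bottom, the rows of an RCEF matrix are at each moment either in the
  span of the unit vectors met so far or the next unit vector, called a pivot. Once the first \<open>d\<close> pivots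
  have been met, they may be regarded as constants: what follows is a word with letters in
  \<open>F\<^sup>d\<close> until the next pivot appears, and after that pivot it is a word of the same
  kind with \<open>d + 1\<close> in place of \<open>d\<close> and one parameter fewer. For the inductive step,
  \<open>colour_depends_on_letter_prefix\<close> uses the induction hypothesis after the first pivot to make the
  colour depend only on the letters before it, \<open>colour_depends_on_prefix_length\<close> uses the Hales--Jewett
  theorem to make it depend only on their number, and the pigeonhole principle, in the form of
  \<open>large_colour_class\<close> and \<open>select_positions\<close>, removes this last dependence.

  On the side of matrices, the existence of the factorisation comes from reading the rows one by one and
  adding a pivot whenever a row is independent of the earlier ones (\<open>echelon_factorisation\<close>), and its
  uniqueness from the fact that an invertible matrix which carries one echelon word to another fixes the
  pivots one after the other (\<open>echelon_substitution_rigid\<close>).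
\<close>

section \<open>The Hales--Jewett theorem\<close>

text \<open>
  A colouring by functions on a finite set \<open>P\<close> into \<open>r\<close> colours is again a colouring by finitely many
  natural numbers. Colourings are total functions with values below \<open>r\<close>, so \<open>\<phi>\<close> has to encode total
  functions, of which it remembers the restriction to \<open>P\<close>.
\<close>


lemma product_colouring:
  fixes P :: "'p set" and r :: nat
  assumes "finite P"
  obtains s and \<phi> :: "('p \<Rightarrow> nat) \<Rightarrow> nat"
  where "\<forall>f. (\<forall>p. f p < r) \<longrightarrow> \<phi> f < s"
    and "\<forall>f g. (\<forall>p. f p < r) \<longrightarrow> (\<forall>p. g p < r) \<longrightarrow> \<phi> f = \<phi> g \<longrightarrow> (\<forall>p\<in>P. f p = g p)"
proof -
  have fin: "finite (PiE P (\<lambda>_. {..<r}))"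
    using assms by (intro finite_PiE) auto
  from finite_imp_inj_to_nat_seg[OF fin]
  obtain \<psi> :: "('p \<Rightarrow> nat) \<Rightarrow> nat" and s
    where img: "\<psi> ` PiE P (\<lambda>_. {..<r}) = {i. i < s}" and inj: "inj_on \<psi> (PiE P (\<lambda>_. {..<r}))"
    by blast
  have mem: "restrict f P \<in> PiE P (\<lambda>_. {..<r})" if "\<And>p. f p < r" for f
    using that by auto
  show thesis
  proof (rule that; intro allI impI ballI)
    fix f :: "'p \<Rightarrow> nat" assume "\<forall>p. f p < r"
    then show "\<psi> (restrict f P) < s" using mem img by blast
  next
    fix f g :: "'p \<Rightarrow> nat" and p
    assume fg: "\<forall>p. f p < r" "\<forall>p. g p < r" "\<psi> (restrict f P) = \<psi> (restrict g P)" and p: "p \<in> P"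
    have "restrict f P = restrict g P" using inj mem fg by (meson inj_onD)
    then show "f p = g p" using p by (metis restrict_apply')
  qed
qed

definition fill :: "'b \<Rightarrow> 'b option list \<Rightarrow> 'b list" where
  "fill a W = map (case_option a id) W"

text \<open>
  The letter \<open>None\<close> is the variable of the word, and it has to occur. The words \<open>fill a W\<close>, for \<open>a\<close> in
  \<open>A\<close>, form a combinatorial line.
\<close>

definition variable_words :: "'b set \<Rightarrow> nat \<Rightarrow> 'b option list set" where
  "variable_words A n = {W. length W = n \<and> None \<in> set W \<and> set W \<subseteq> insert None (Some ` A)}"

lemma fill_append [simp]: "fill a (V @ W) = fill a V @ fill a W"
  by (simp add: fill_def)

lemma length_fill [simp]: "length (fill a W) = length W"
  by (simp add: fill_def)

lemma fill_map_Some [simp]: "fill a (map Some u) = u"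
  by (induction u) (auto simp: fill_def)

lemma fill_in_lists: "W \<in> variable_words A n \<Longrightarrow> a \<in> A \<Longrightarrow> set (fill a W) \<subseteq> A"
  by (auto simp: fill_def variable_words_def split: option.splits)

definition constant_line :: "('b list \<Rightarrow> nat) \<Rightarrow> 'b set \<Rightarrow> nat \<Rightarrow> bool" where
  "constant_line c A n \<longleftrightarrow>
     (\<exists>W\<in>variable_words A n. \<forall>a\<in>A. \<forall>b\<in>A. c (fill a W) = c (fill b W))"

text \<open>
  The lines of colour-focusing proofs: each has a constant colour over \<open>A\<close>, the set of
  these colours contains \<open>J\<close>, and all lines meet in the word \<open>f\<close> when the variable is
  replaced by the additional letter \<open>x\<close>.
\<close>

definition focused_lines :: "('b list \<Rightarrow> nat) \<Rightarrow> 'b set \<Rightarrow> 'b \<Rightarrow> nat \<Rightarrow> 'b list \<Rightarrow> nat set \<Rightarrow> bool" where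
  "focused_lines c A x n f J \<longleftrightarrow> length f = n \<and> set f \<subseteq> insert x A \<and>
     (\<forall>i\<in>J. \<exists>W\<in>variable_words (insert x A) n. fill x W = f \<and> (\<forall>a\<in>A. c (fill a W) = i))"

lemma constant_lineI:
  "W \<in> variable_words A n \<Longrightarrow> (\<And>a. a \<in> A \<Longrightarrow> c (fill a W) = i) \<Longrightarrow> constant_line c A n"
  by (auto simp: constant_line_def)

text \<open>
  Every application of the Hales--Jewett theorem for \<open>A\<close> adds one colour to the focused lines, unless a
  line over the larger alphabet appears. In front of the focused lines for the induced colouring \<open>c'\<close> of
  the last \<open>n\<close> letters one puts a variable word \<open>V\<close> along which the whole colouring of the last \<open>n\<close>
  letters is constant over \<open>A\<close>. The variable then runs through both parts at once, which keeps the old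
  colours, and the line on which only \<open>V\<close> varies while the end stays at \<open>f\<close> has the colour \<open>c' f\<close>. If
  that colour is old, an old line is constant over the larger alphabet.
\<close>

lemma colour_focusing:
  fixes A :: "'b set" and r :: nat
  assumes "finite A" and "A \<noteq> {}"
    and HJ: "\<And>s. \<exists>n. \<forall>c. (\<forall>u. c u < s) \<longrightarrow> constant_line c A n"
  shows "\<exists>n. \<forall>c. (\<forall>u. c u < r) \<longrightarrow> constant_line c (insert x A) n \<or>
          (\<exists>f J. card J = j \<and> J \<subseteq> {..<r} \<and> focused_lines c A x n f J)"
proof (induction j)
  case 0
  have "focused_lines c A x 0 [] {}" for c by (simp add: focused_lines_def)
  then show ?case by (metis card.empty empty_subsetI)
next
  case (Suc j)
  let ?B = "insert x A"
  from Suc obtain n where n: "\<forall>c. (\<forall>u. c u < r) \<longrightarrow> constant_line c ?B n \<or>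
          (\<exists>f J. card J = j \<and> J \<subseteq> {..<r} \<and> focused_lines c A x n f J)" ..
  define P where "P = {v. set v \<subseteq> ?B \<and> length v = n}"
  have "finite P" unfolding P_def using assms(1) by (intro finite_lists_length_eq) auto
  from product_colouring[OF this, of r] obtain s and \<phi> :: "('b list \<Rightarrow> nat) \<Rightarrow> nat"
    where \<phi>s [rule_format]: "\<forall>f. (\<forall>p. f p < r) \<longrightarrow> \<phi> f < s"
      and \<phi> [rule_format]: "\<forall>f g. (\<forall>p. f p < r) \<longrightarrow> (\<forall>p. g p < r) \<longrightarrow> \<phi> f = \<phi> g \<longrightarrow>
                  (\<forall>p\<in>P. f p = g p)" .
  from HJ[of s] obtain n' where n': "\<forall>c. (\<forall>u. c u < s) \<longrightarrow> constant_line c A n'" ..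
  obtain a0 where a0: "a0 \<in> A" using assms by blast
  show ?case
  proof (intro exI[of _ "n' + n"] allI impI)
    fix c :: "'b list \<Rightarrow> nat" assume c: "\<forall>u. c u < r"
    have "\<forall>u. \<phi> (\<lambda>v. c (u @ v)) < s" using \<phi>s c by simp
    then have "constant_line (\<lambda>u. \<phi> (\<lambda>v. c (u @ v))) A n'" using n' by simp
    then obtain V where V: "V \<in> variable_words A n'"
      and V_line: "\<And>a b. a \<in> A \<Longrightarrow> b \<in> A \<Longrightarrow> \<phi> (\<lambda>v. c (fill a V @ v)) = \<phi> (\<lambda>v. c (fill b V @ v))"
      unfolding constant_line_def by blast
    have Veq: "c (fill a V @ v) = c (fill a0 V @ v)" if "a \<in> A" "v \<in> P" for a v
      by (rule \<phi>[OF _ _ V_line[OF that(1) a0] that(2)]) (use c in auto)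
    define c' where "c' = (\<lambda>v. c (fill a0 V @ v))"
    have extend: "constant_line c ?B (n' + n)"
      if "W \<in> variable_words ?B n" "\<And>a. a \<in> ?B \<Longrightarrow> c' (fill a W) = i" for W i
    proof (rule constant_lineI)
      show "map Some (fill a0 V) @ W \<in> variable_words ?B (n' + n)"
        using that(1) V fill_in_lists[OF V a0] by (auto simp: variable_words_def)
      show "c (fill a (map Some (fill a0 V) @ W)) = i" if "a \<in> ?B" for a
        using \<open>a \<in> ?B \<Longrightarrow> c' (fill a W) = i\<close> that by (simp add: c'_def)
    qed
    have "\<forall>u. c' u < r" using c by (simp add: c'_def)
    with n have "constant_line c' ?B n \<or>
        (\<exists>f J. card J = j \<and> J \<subseteq> {..<r} \<and> focused_lines c' A x n f J)" by simp
    then consider (line) "constant_line c' ?B n"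
      | (focus) f J where "card J = j" "J \<subseteq> {..<r}" "focused_lines c' A x n f J"
      by blast
    then show "constant_line c ?B (n' + n) \<or>
        (\<exists>f J. card J = Suc j \<and> J \<subseteq> {..<r} \<and> focused_lines c A x (n' + n) f J)"
    proof cases
      case line
      then show ?thesis using extend unfolding constant_line_def[of c'] by (metis insertI1)
    next
      case focus
      from focus(3) have f: "length f = n" "set f \<subseteq> ?B"
        and lines: "\<And>i. i \<in> J \<Longrightarrow> \<exists>W\<in>variable_words ?B n. fill x W = f \<and> (\<forall>a\<in>A. c' (fill a W) = i)"
        unfolding focused_lines_def by auto
      have fP: "f \<in> P" using f by (simp add: P_def)
      show ?thesis
      proof (cases "c' f \<in> J")
        case True
        then obtain W where W: "W \<in> variable_words ?B n" "fill x W = f"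
          "\<forall>a\<in>A. c' (fill a W) = c' f" using lines by blast
        have "constant_line c ?B (n' + n)"
          by (rule extend[OF W(1), of "c' f"]) (use W in auto)
        then show ?thesis ..
      next
        case False
        have new: "\<exists>W\<in>variable_words ?B (n' + n). fill x W = fill x V @ f \<and> (\<forall>a\<in>A. c (fill a W) = i)"
          if i: "i \<in> insert (c' f) J" for i
        proof (cases "i = c' f")
          case True
          show ?thesis
          proof (intro bexI conjI ballI)
            show "V @ map Some f \<in> variable_words ?B (n' + n)"
              using V f by (auto simp: variable_words_def)
            show "fill x (V @ map Some f) = fill x V @ f" by simp
            show "c (fill a (V @ map Some f)) = i" if "a \<in> A" for a
              using True Veq[OF that fP] by (simp add: c'_def)
          qed
        next
          case False
          then obtain W where W: "W \<in> variable_words ?B n" "fill x W = f" "\<forall>a\<in>A. c' (fill a W) = i"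
            using lines i by blast
          show ?thesis
          proof (intro bexI conjI ballI)
            show "V @ W \<in> variable_words ?B (n' + n)"
              using V W(1) by (auto simp: variable_words_def)
            show "fill x (V @ W) = fill x V @ f" using W by simp
            show "c (fill a (V @ W)) = i" if "a \<in> A" for a
            proof -
              have "fill a W \<in> P"
                using W(1) fill_in_lists[OF W(1), of a] that by (auto simp: P_def variable_words_def)
              then show ?thesis using Veq[OF that] W(3) that by (simp add: c'_def)
            qed
          qed
        qed
        have "length (fill x V @ f) = n' + n"
          using V f by (simp add: variable_words_def)
        moreover have "set (fill x V @ f) \<subseteq> ?B"
          using V f by (auto simp: variable_words_def fill_def split: option.splits)
        ultimately have "focused_lines c A x (n' + n) (fill x V @ f) (insert (c' f) J)"
          using new unfolding focused_lines_def by simp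
        moreover have "card (insert (c' f) J) = Suc j"
          using False focus(1,2) by (metis card_insert_disjoint finite_lessThan finite_subset)
        moreover have "insert (c' f) J \<subseteq> {..<r}"
          using focus(2) c by (simp add: c'_def)
        ultimately show ?thesis by blast
      qed
    qed
  qed
qed

text \<open>
  With \<open>r\<close> focused lines of different colours, the colour of their common word \<open>f\<close> is the colour of
  one of them, and this line is then constant also at the new letter.
\<close>

theorem Hales_Jewett:
  fixes A :: "'b set"
  assumes "finite A"
  shows "\<exists>n. \<forall>c. (\<forall>u. c u < (r::nat)) \<longrightarrow> constant_line c A n"
  using assms
proof (induction A arbitrary: r)
  case empty
  have "constant_line c {} 1" for c :: "'b list \<Rightarrow> nat"
    by (rule constant_lineI[of "[None]"]) (auto simp: variable_words_def)
  then show ?case by blast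
next
  case (insert x A)
  show ?case
  proof (cases "A = {}")
    case True
    have "constant_line c {x} 1" for c :: "'b list \<Rightarrow> nat"
      by (rule constant_lineI[of "[None]" _ _ _ "c [x]"]) (auto simp: variable_words_def fill_def)
    then show ?thesis using True by blast
  next
    case False
    from colour_focusing[OF insert.hyps(1) False insert.IH, of r x r]
    obtain n where n: "\<forall>c. (\<forall>u. c u < r) \<longrightarrow> constant_line c (insert x A) n \<or>
          (\<exists>f J. card J = r \<and> J \<subseteq> {..<r} \<and> focused_lines c A x n f J)" ..
    show ?thesis
    proof (intro exI[of _ n] allI impI)
      fix c :: "'b list \<Rightarrow> nat" assume c: "\<forall>u. c u < r"
      with n have "constant_line c (insert x A) n \<or>
          (\<exists>f J. card J = r \<and> J \<subseteq> {..<r} \<and> focused_lines c A x n f J)" by simp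
      then consider "constant_line c (insert x A) n"
        | f J where "card J = r" "J \<subseteq> {..<r}" "focused_lines c A x n f J"
        by blast
      then show "constant_line c (insert x A) n"
      proof cases
        case 2
        then have "J = {..<r}" by (simp add: card_subset_eq)
        then have "c f \<in> J" using c by simp
        with 2(3) obtain W where W: "W \<in> variable_words (insert x A) n" "fill x W = f"
          "\<forall>a\<in>A. c (fill a W) = c f" unfolding focused_lines_def by blast
        show ?thesis
          by (rule constant_lineI[OF W(1), of _ "c f"]) (use W in auto)
      qed
    qed
  qed
qed

section \<open>Echelon words\<close>

text \<open>
  Row vectors are functions on \<open>nat\<close> with zero entries from some index on, so that the same
  vector belongs to the spaces of all sufficiently large dimensions and no coercions are needed when the
  number of columns grows in an induction.
\<close>

definition supported_below :: "nat \<Rightarrow> (nat \<Rightarrow> 'a::field) \<Rightarrow> bool" where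
  "supported_below d v \<longleftrightarrow> (\<forall>j\<ge>d. v j = 0)"

definition unit_fun :: "nat \<Rightarrow> nat \<Rightarrow> 'a::field" where
  "unit_fun i = (\<lambda>j. if j = i then 1 else 0)"

text \<open>
  The rows \<open>xs\<close> continue a matrix in RCEF with \<open>k\<close> columns and full column rank whose first \<open>d\<close> pivots
  have been met: \<open>echelon 0 xs k\<close> is RCEF proper, and \<open>echelon d xs k\<close> says that the first \<open>d\<close> unit
  vectors followed by \<open>xs\<close> are in RCEF.
\<close>

fun echelon :: "nat \<Rightarrow> (nat \<Rightarrow> 'a::field) list \<Rightarrow> nat \<Rightarrow> bool" where
  "echelon d [] k \<longleftrightarrow> d = k"
| "echelon d (v # vs) k \<longleftrightarrow>
     supported_below d v \<and> echelon d vs k \<or> v = unit_fun d \<and> echelon (Suc d) vs k"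

text \<open>
  The product of the row \<open>v\<close> with the matrix whose rows are the first \<open>d\<close> unit vectors followed by \<open>Y\<close>.
  The rows of the product of two matrices, each with an identity block of size \<open>d\<close> on
  top, are therefore the first \<open>d\<close> unit vectors followed by \<open>map (substitute d Y) R\<close>.
\<close>

definition substitute :: "nat \<Rightarrow> (nat \<Rightarrow> 'a::field) list \<Rightarrow> (nat \<Rightarrow> 'a) \<Rightarrow> nat \<Rightarrow> 'a" where
  "substitute d Y v = (\<lambda>j. (if j < d then v j else 0) + (\<Sum>i<length Y. v (d + i) * (Y ! i) j))"

text \<open>
  Column \<open>d\<close> is reserved for a pivot that has become a constant. The later pivots of a word that does not
  use this constant move one column to the right.
\<close>

definition insert_column :: "nat \<Rightarrow> (nat \<Rightarrow> 'a::field) \<Rightarrow> nat \<Rightarrow> 'a" where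
  "insert_column d v = (\<lambda>j. if j < d then v j else if j = d then 0 else v (j - 1))"

text \<open>
  The linear analogue of parameter words of length \<open>n\<close>, with letters in \<open>F\<^sup>d\<close> and \<open>k\<close> parameters: below
  a pivot, combinations of letters and of the parameters already met may occur.
\<close>

definition echelon_words :: "nat \<Rightarrow> nat \<Rightarrow> nat \<Rightarrow> (nat \<Rightarrow> 'a::field) list set" where
  "echelon_words d n k = {xs. length xs = n \<and> echelon d xs (d + k)}"

abbreviation letter_prefix :: "nat \<Rightarrow> (nat \<Rightarrow> 'a::field) list \<Rightarrow> (nat \<Rightarrow> 'a) list" where
  "letter_prefix d \<equiv> takeWhile (supported_below d)"

lemma not_supported_unit_fun [simp]: "\<not> supported_below d (unit_fun d :: nat \<Rightarrow> 'a::field)"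
  by (auto simp: supported_below_def unit_fun_def)

lemma supported_below_unit_fun: "i < d \<Longrightarrow> supported_below d (unit_fun i)"
  by (auto simp: supported_below_def unit_fun_def)

lemma supported_below_mono: "supported_below d v \<Longrightarrow> d \<le> d' \<Longrightarrow> supported_below d' v"
  by (auto simp: supported_below_def)

lemma supported_below_zero [simp]: "supported_below d (\<lambda>_. 0)"
  by (auto simp: supported_below_def)

lemma finite_supported_below: "finite {v :: nat \<Rightarrow> 'a::{finite,field}. supported_below d v}"
proof -
  have "{v :: nat \<Rightarrow> 'a. supported_below d v} =
      {v. \<forall>x. (x \<in> {..<d} \<longrightarrow> v x \<in> UNIV) \<and> (x \<notin> {..<d} \<longrightarrow> v x = 0)}"
    by (auto simp: supported_below_def)
  also have "finite \<dots>" by (rule finite_set_of_finite_funs) auto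
  finally show ?thesis .
qed

lemma substitute_letter [simp]: "supported_below d v \<Longrightarrow> substitute d Y v = v"
  by (auto simp: supported_below_def substitute_def fun_eq_iff)

lemma substitute_pivot: "i < length Y \<Longrightarrow> substitute d Y (unit_fun (d + i)) = Y ! i"
proof -
  assume "i < length Y"
  then have "(\<Sum>l<length Y. unit_fun (d + i) (d + l) * (Y ! l) j) = (Y ! i) j" for j
    by (simp add: unit_fun_def if_distrib[of "\<lambda>t. t * _"] cong: if_cong)
  then show ?thesis by (auto simp: substitute_def unit_fun_def fun_eq_iff)
qed

lemma substitute_first_pivot [simp]: "substitute d (y # Y) (unit_fun d) = y"
  using substitute_pivot[of 0 "y # Y" d] by simp

text \<open>
  If the first parameter is substituted by itself, it acts as a constant from then on.
\<close>

lemma substitute_Cons_unit: "substitute d (unit_fun d # Y) v = substitute (Suc d) Y v"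
proof
  fix j
  show "substitute d (unit_fun d # Y) v j = substitute (Suc d) Y v j"
    by (auto simp: substitute_def sum.lessThan_Suc_shift unit_fun_def less_Suc_eq
        simp del: sum.lessThan_Suc)
qed

lemma substitute_insert_column [simp]:
  "substitute d (y # Y) (insert_column d v) = substitute d Y v"
  by (auto simp: substitute_def insert_column_def sum.lessThan_Suc_shift fun_eq_iff
      simp del: sum.lessThan_Suc)

lemma substitute_substitute:
  "substitute d Z (substitute d Y v) = substitute d (map (substitute d Z) Y) v"
proof
  fix j
  have *: "substitute d Z (substitute d Y v) j
    = (if j < d then v j + (\<Sum>i<length Y. v (d + i) * (Y ! i) j) else 0)
      + (\<Sum>l<length Z. \<Sum>i<length Y. v (d + i) * ((Y ! i) (d + l) * (Z ! l) j))"
    by (simp add: substitute_def sum_distrib_right mult.assoc)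
  have "substitute d (map (substitute d Z) Y) v j
    = (if j < d then v j else 0) + (\<Sum>i<length Y. v (d + i) * (if j < d then (Y ! i) j else 0))
     + (\<Sum>i<length Y. \<Sum>l<length Z. v (d + i) * ((Y ! i) (d + l) * (Z ! l) j))"
    by (simp add: substitute_def distrib_left sum.distrib sum_distrib_left add.assoc)
  also have "\<dots> = substitute d Z (substitute d Y v) j"
    unfolding * by (subst sum.swap) auto
  finally show "substitute d Z (substitute d Y v) j = substitute d (map (substitute d Z) Y) v j" ..
qed

lemma map_substitute_substitute:
  "map (substitute d Z) (map (substitute d Y) R) = map (substitute d (map (substitute d Z) Y)) R"
  by (simp add: substitute_substitute)

lemma echelon_le: "echelon d xs k \<Longrightarrow> d \<le> k"
  by (induction xs arbitrary: d) (auto dest: Suc_leD)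

lemma echelon_imp_supported: "echelon d xs k \<Longrightarrow> v \<in> set xs \<Longrightarrow> supported_below k v"
proof (induction xs arbitrary: d)
  case (Cons x xs)
  then show ?case
    using supported_below_mono supported_below_unit_fun echelon_le
    by (metis (no_types, lifting) Suc_le_eq echelon.simps(2) set_ConsD)
qed auto

lemma echelon_append: "echelon d xs k \<Longrightarrow> echelon k ys l \<Longrightarrow> echelon d (xs @ ys) l"
  by (induction xs arbitrary: d) auto

lemma echelon_letters_iff: "echelon k xs k \<longleftrightarrow> (\<forall>v\<in>set xs. supported_below k v)"
  by (induction xs) (auto dest: echelon_le)

lemma echelon_insert_column:
  "echelon d' xs k \<Longrightarrow> d \<le> d' \<Longrightarrow> echelon (Suc d') (map (insert_column d) xs) (Suc k)"
proof (induction xs arbitrary: d')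
  case (Cons v xs)
  have 1: "supported_below (Suc d') (insert_column d v)" if "supported_below d' v"
    using that Cons.prems by (auto simp: supported_below_def insert_column_def)
  have 2: "insert_column d (unit_fun d') = unit_fun (Suc d')"
    using Cons.prems by (auto simp: insert_column_def unit_fun_def fun_eq_iff)
  show ?case using Cons 1 2 by (auto simp: le_SucI)
qed auto

text \<open>
  RCEF matrices of full rank are closed under multiplication. While \<open>R\<close> is read and \<open>p\<close> of its pivots
  have been met, the first \<open>p\<close> rows of \<open>Z\<close> have been used, and these contain \<open>q\<close> pivots. A row of \<open>R\<close>
  that is not a pivot is a combination of the rows of \<open>Z\<close> that have been used, and a pivot calls for the next row of \<open>Z\<close>,
  which either is a pivot itself or brings nothing new.
\<close>

lemma echelon_substitute_aux:
  assumes "echelon p R k" "length Z = k" "\<forall>i<p. supported_below q (Z ! i)" "echelon q (drop p Z) l"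
  shows "echelon q (map (substitute 0 Z) R) l"
  using assms
proof (induction R arbitrary: p q)
  case (Cons v R)
  have pk: "p \<le> k" using Cons.prems(1) echelon_le by blast
  consider "supported_below p v" "echelon p R k" | "v = unit_fun p" "echelon (Suc p) R k"
    using Cons.prems(1) by auto
  then show ?case
  proof cases
    case 1
    have "supported_below q (substitute 0 Z v)"
      unfolding supported_below_def substitute_def
    proof (intro allI impI)
      fix j assume j: "q \<le> j"
      have "v i * (Z ! i) j = 0" for i
        using 1(1) Cons.prems(3) j by (cases "i < p") (auto simp: supported_below_def)
      then show "(if j < 0 then v j else 0) + (\<Sum>i<length Z. v (0 + i) * (Z ! i) j) = 0" by simp
    qed
    then show ?thesis using Cons 1 by auto
  next
    case 2
    have "p < k" using echelon_le[OF 2(2)] by simp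
    then have dr: "drop p Z = Z ! p # drop (Suc p) Z" using Cons.prems(2) by (simp add: Cons_nth_drop_Suc)
    have v: "substitute 0 Z v = Z ! p" using substitute_pivot[of p Z 0] 2 \<open>p < k\<close> Cons.prems(2) by simp
    from Cons.prems(4) consider "supported_below q (Z ! p)" "echelon q (drop (Suc p) Z) l"
      | "Z ! p = unit_fun q" "echelon (Suc q) (drop (Suc p) Z) l" unfolding dr by auto
    then show ?thesis
    proof cases
      case 1
      then have "echelon q (map (substitute 0 Z) R) l"
        using Cons.IH[OF 2(2)] Cons.prems by (auto simp: less_Suc_eq)
      then show ?thesis using 1 v by simp
    next
      case qq: 2
      have "\<forall>i<Suc p. supported_below (Suc q) (Z ! i)"
        using Cons.prems(3) qq(1)
        by (metis less_Suc_eq supported_below_mono supported_below_unit_fun le_SucI order_refl lessI)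
      then have "echelon (Suc q) (map (substitute 0 Z) R) l"
        using Cons.IH[OF 2(2)] Cons.prems(2) qq(2) by blast
      then show ?thesis using qq v by simp
    qed
  qed
qed (use echelon_le in fastforce)

lemma substitute_eq_full: "substitute d Y = substitute 0 (map unit_fun [0..<d] @ Y)"
proof (induction d arbitrary: Y)
  case (Suc d)
  have "substitute (Suc d) Y = substitute d (unit_fun d # Y)"
    using substitute_Cons_unit[of d Y] by (simp add: fun_eq_iff)
  then show ?case using Suc[of "unit_fun d # Y"] by simp
qed simp

lemma substitute_in_echelon_words:
  assumes "R \<in> echelon_words d n m" "Y \<in> echelon_words d m k"
  shows "map (substitute d Y) R \<in> echelon_words d n k"
proof -
  have "echelon d (map (substitute 0 (map unit_fun [0..<d] @ Y)) R) (d + k)"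
    using assms by (intro echelon_substitute_aux[where p = d and k = "d + m"])
      (auto simp: echelon_words_def nth_append supported_below_unit_fun)
  then show ?thesis using assms by (simp add: echelon_words_def substitute_eq_full[of d Y])
qed

lemma Cons_in_echelon_words:
  "v # Y \<in> echelon_words d (Suc m) k \<longleftrightarrow>
     supported_below d v \<and> Y \<in> echelon_words d m k \<or>
     v = unit_fun d \<and> (\<exists>k'. k = Suc k' \<and> Y \<in> echelon_words (Suc d) m k')"
proof (cases k)
  case 0
  then show ?thesis using echelon_le[of "Suc d" Y d] by (auto simp: echelon_words_def)
next
  case (Suc k')
  then show ?thesis by (auto simp: echelon_words_def)
qed

text \<open>
  The case distinction behind all inductions below: a word begins with a letter or with its first
  parameter.
\<close>

lemma echelon_words_SucE:
  assumes "Y \<in> echelon_words d (Suc m) k"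
  obtains (letter) v Y' where "Y = v # Y'" "supported_below d v" "Y' \<in> echelon_words d m k"
    | (pivot) Y' k' where "Y = unit_fun d # Y'" "k = Suc k'" "Y' \<in> echelon_words (Suc d) m k'"
proof -
  obtain v Y' where "Y = v # Y'" using assms by (cases Y) (auto simp: echelon_words_def)
  then show thesis
    using assms that by (auto simp: Cons_in_echelon_words)
qed

lemma echelon_words_0: "Y \<in> echelon_words d 0 k \<longleftrightarrow> Y = [] \<and> k = 0"
  by (auto simp: echelon_words_def)

lemma insert_column_in_echelon_words:
  "S \<in> echelon_words d n m \<Longrightarrow> map (insert_column d) S \<in> echelon_words (Suc d) n m"
  by (auto simp: echelon_words_def dest: echelon_insert_column)

lemma echelon_words_append:
  "xs \<in> echelon_words d a k \<Longrightarrow> ys \<in> echelon_words (d + k) b l \<Longrightarrow> xs @ ys \<in> echelon_words d (a + b) (k + l)"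
  by (auto simp: echelon_words_def add.assoc intro: echelon_append)

section \<open>Ramsey theorem for echelon words\<close>

text \<open>
  A combinatorial line over the alphabet \<open>F\<^sup>d\<close> is an echelon word with one parameter, namely the pivot
  \<open>unit_fun d\<close> in place of the variable.
\<close>

lemma letter_line:
  fixes r d :: nat
  shows "\<exists>a. \<forall>c :: (nat \<Rightarrow> 'a::{finite,field}) list \<Rightarrow> nat. (\<forall>u. c u < r) \<longrightarrow>
    (\<exists>T\<in>echelon_words d a 1. unit_fun d \<in> set T \<and>
       (\<forall>v. supported_below d v \<longrightarrow> (\<forall>x\<in>set (map (substitute d [v]) T). supported_below d x)) \<and>
       set T \<subseteq> insert (unit_fun d) {v. supported_below d v} \<and>
       (\<forall>v w. supported_below d v \<longrightarrow> supported_below d w \<longrightarrow>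
          c (map (substitute d [v]) T) = c (map (substitute d [w]) T)))"
proof -
  let ?A = "{v :: nat \<Rightarrow> 'a. supported_below d v}"
  from Hales_Jewett[OF finite_supported_below[where 'a = 'a and d = d], of r] obtain a
    where a: "\<forall>c. (\<forall>u. c u < r) \<longrightarrow> constant_line c ?A a" ..
  show ?thesis
  proof (intro exI[of _ a] allI impI)
    fix c :: "(nat \<Rightarrow> 'a) list \<Rightarrow> nat" assume "\<forall>u. c u < r"
    with a have "constant_line c ?A a" by simp
    then obtain W where W: "W \<in> variable_words ?A a"
      and mono: "\<And>v w. v \<in> ?A \<Longrightarrow> w \<in> ?A \<Longrightarrow> c (fill v W) = c (fill w W)"
      unfolding constant_line_def by blast
    define T where "T = fill (unit_fun d) W"
    have letters: "set W \<subseteq> insert None (Some ` ?A)" "None \<in> set W" "length W = a"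
      using W by (auto simp: variable_words_def)
    have setT: "set T \<subseteq> insert (unit_fun d) ?A"
      using letters(1) by (auto simp: T_def fill_def split: option.splits)
    have "unit_fun d \<in> set T" using letters(2) by (force simp: T_def fill_def)
    have tail: "echelon (Suc d) T (Suc d)" if "set T \<subseteq> insert (unit_fun d) ?A"
      for T :: "(nat \<Rightarrow> 'a) list"
    proof -
      have "supported_below (Suc d) x" if "x \<in> insert (unit_fun d) ?A" for x :: "nat \<Rightarrow> 'a"
        using that supported_below_unit_fun[of d "Suc d"] supported_below_mono[of d x "Suc d"] by auto
      then show ?thesis using that by (auto simp: echelon_letters_iff)
    qed
    have "echelon d T (Suc d)" if "set T \<subseteq> insert (unit_fun d) ?A" "unit_fun d \<in> set T"
      for T :: "(nat \<Rightarrow> 'a) list"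
      using that tail by (induction T) auto
    then have ech: "T \<in> echelon_words d a 1"
      using setT \<open>unit_fun d \<in> set T\<close> letters(3) by (simp add: echelon_words_def T_def)
    have fillT: "map (substitute d [v]) T = fill v W" for v
      using letters(1) by (auto simp: T_def fill_def split: option.splits)
    show "\<exists>T\<in>echelon_words d a 1. unit_fun d \<in> set T \<and>
       (\<forall>v. supported_below d v \<longrightarrow> (\<forall>x\<in>set (map (substitute d [v]) T). supported_below d x)) \<and>
       set T \<subseteq> insert (unit_fun d) {v. supported_below d v} \<and>
       (\<forall>v w. supported_below d v \<longrightarrow> supported_below d w \<longrightarrow>
          c (map (substitute d [v]) T) = c (map (substitute d [w]) T))"
    proof (intro bexI[OF _ ech] conjI allI impI)
      fix v w :: "nat \<Rightarrow> 'a" assume "supported_below d v" "supported_below d w"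
      then show "c (map (substitute d [v]) T) = c (map (substitute d [w]) T)"
        unfolding fillT by (intro mono) simp_all
    next
      fix v :: "nat \<Rightarrow> 'a" assume "supported_below d v"
      then show "\<forall>x\<in>set (map (substitute d [v]) T). supported_below d x"
        unfolding fillT using fill_in_lists[OF W, of v] by blast
    qed (fact \<open>unit_fun d \<in> set T\<close> setT)+
  qed
qed

lemma substitute_in_line:
  assumes "v \<in> insert (unit_fun d) {v. supported_below d v}"
  shows "substitute d (y # Y) v = substitute d [y] v"
  using assms by auto

text \<open>
  The word \<open>T\<close> is built from the front. Its first block \<open>T0\<close> is a line on which the colour of every short
  continuation is constant, so substituting a letter for the first parameter has the same effect for all
  letters, and the remaining parameters are treated by the induction hypothesis. If
  instead the first parameter stays, the prefix ends inside \<open>T0\<close>, at a place that does not depend on \<open>Y\<close>.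
\<close>

lemma colour_depends_on_prefix_length:
  fixes m r d :: nat
  shows "\<exists>M. \<forall>g :: (nat \<Rightarrow> 'a::{finite,field}) list \<Rightarrow> nat. (\<forall>u. g u < r) \<longrightarrow>
    (\<exists>T\<in>echelon_words d M m. \<forall>k. \<forall>Y\<in>echelon_words d m k. \<forall>Z\<in>echelon_words d m k.
       length (letter_prefix d Y) = length (letter_prefix d Z) \<longrightarrow>
       g (letter_prefix d (map (substitute d Y) T)) = g (letter_prefix d (map (substitute d Z) T)))"
proof (induction m)
  case 0
  show ?case
    by (intro exI[of _ 0]) (auto simp: echelon_words_0)
next
  case (Suc m)
  then obtain b where b [THEN spec, THEN mp]: "\<forall>g :: (nat \<Rightarrow> 'a) list \<Rightarrow> nat. (\<forall>u. g u < r) \<longrightarrow>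
    (\<exists>T\<in>echelon_words d b m. \<forall>k. \<forall>Y\<in>echelon_words d m k. \<forall>Z\<in>echelon_words d m k.
       length (letter_prefix d Y) = length (letter_prefix d Z) \<longrightarrow>
       g (letter_prefix d (map (substitute d Y) T)) = g (letter_prefix d (map (substitute d Z) T)))"
    ..
  \<comment> \<open>all letter prefixes that can arise from the last \<open>b\<close> letters\<close>
  define P where "P = {w :: (nat \<Rightarrow> 'a) list. set w \<subseteq> {v. supported_below d v} \<and> length w \<le> b}"
  have "finite P" unfolding P_def by (intro finite_lists_length_le finite_supported_below)
  from product_colouring[OF this, of r] obtain s and \<phi> :: "((nat \<Rightarrow> 'a) list \<Rightarrow> nat) \<Rightarrow> nat"
    where \<phi>s [rule_format]: "\<forall>f. (\<forall>p. f p < r) \<longrightarrow> \<phi> f < s"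
      and \<phi> [rule_format]: "\<forall>f g. (\<forall>p. f p < r) \<longrightarrow> (\<forall>p. g p < r) \<longrightarrow> \<phi> f = \<phi> g \<longrightarrow>
                  (\<forall>p\<in>P. f p = g p)" .
  obtain a where a [THEN spec, THEN mp]: "\<forall>c :: (nat \<Rightarrow> 'a) list \<Rightarrow> nat. (\<forall>u. c u < s) \<longrightarrow>
    (\<exists>T\<in>echelon_words d a 1. unit_fun d \<in> set T \<and>
       (\<forall>v. supported_below d v \<longrightarrow> (\<forall>x\<in>set (map (substitute d [v]) T). supported_below d x)) \<and>
       set T \<subseteq> insert (unit_fun d) {v. supported_below d v} \<and>
       (\<forall>v w. supported_below d v \<longrightarrow> supported_below d w \<longrightarrow>
          c (map (substitute d [v]) T) = c (map (substitute d [w]) T)))"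
    using letter_line[of s d] ..
  show ?case
  proof (intro exI[of _ "a + b"] allI impI)
    fix g :: "(nat \<Rightarrow> 'a) list \<Rightarrow> nat" assume g: "\<forall>u. g u < r"
    have "\<forall>u. \<phi> (\<lambda>w. g (u @ w)) < s" using \<phi>s g by simp
    from a[OF this] obtain T0 where T0: "T0 \<in> echelon_words d a 1" "unit_fun d \<in> set T0"
      and T0_letters: "\<And>v. supported_below d v \<Longrightarrow>
             \<forall>x\<in>set (map (substitute d [v]) T0). supported_below d x"
      and T0_set: "set T0 \<subseteq> insert (unit_fun d) {v. supported_below d v}"
      and T0_mono: "\<And>v w. supported_below d v \<Longrightarrow> supported_below d w \<Longrightarrow>
             \<phi> (\<lambda>x. g (map (substitute d [v]) T0 @ x)) = \<phi> (\<lambda>x. g (map (substitute d [w]) T0 @ x))"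
      by metis
    define u0 where "u0 = map (substitute d [\<lambda>_. 0]) T0"
    have line: "g (map (substitute d [v]) T0 @ x) = g (u0 @ x)"
      if "supported_below d v" "x \<in> P" for v x
      using \<phi>[OF _ _ T0_mono[OF that(1) supported_below_zero]] g that(2) by (simp add: u0_def)
    define g' where "g' = (\<lambda>x. g (u0 @ x))"
    have "\<forall>u. g' u < r" using g by (simp add: g'_def)
    from b[OF this] obtain T1 where T1: "T1 \<in> echelon_words d b m"
      and T1_mono: "\<And>k Y Z. Y \<in> echelon_words d m k \<Longrightarrow> Z \<in> echelon_words d m k \<Longrightarrow>
       length (letter_prefix d Y) = length (letter_prefix d Z) \<Longrightarrow>
       g' (letter_prefix d (map (substitute d Y) T1)) = g' (letter_prefix d (map (substitute d Z) T1))"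
      by blast
    define T where "T = T0 @ map (insert_column d) T1"
    have T: "T \<in> echelon_words d (a + b) (Suc m)"
      using echelon_words_append[OF T0(1), of "map (insert_column d) T1" b m]
        insert_column_in_echelon_words[OF T1] by (simp add: T_def)
    have map_T: "map (substitute d (y # Y)) T = map (substitute d [y]) T0 @ map (substitute d Y) T1"
      for y Y
      using T0_set substitute_in_line[of _ d y Y] by (auto simp: T_def)
    have letter: "g (letter_prefix d (map (substitute d (v # Y)) T))
        = g' (letter_prefix d (map (substitute d Y) T1))"
      if "supported_below d v" "Y \<in> echelon_words d m k" for v Y k
    proof -
      have "letter_prefix d (map (substitute d (v # Y)) T)
          = map (substitute d [v]) T0 @ letter_prefix d (map (substitute d Y) T1)"
        unfolding map_T by (rule takeWhile_append2) (use T0_letters[OF that(1)] in blast)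
      moreover have "letter_prefix d (map (substitute d Y) T1) \<in> P"
        using substitute_in_echelon_words[OF T1 that(2)]
          length_takeWhile_le[of "supported_below d" "map (substitute d Y) T1"]
        by (auto simp: P_def echelon_words_def dest: set_takeWhileD)
      ultimately show ?thesis using line[OF that(1)] by (simp add: g'_def)
    qed
    have pivot: "letter_prefix d (map (substitute d (unit_fun d # Y)) T) = letter_prefix d T0" for Y
    proof -
      have "map (substitute d [unit_fun d]) T0 = T0"
        using T0_set by (auto intro!: map_idI)
      then show ?thesis unfolding map_T using T0(2)
        by (simp add: takeWhile_append1[of "unit_fun d"])
    qed
    show "\<exists>T\<in>echelon_words d (a + b) (Suc m).
        \<forall>k. \<forall>Y\<in>echelon_words d (Suc m) k. \<forall>Z\<in>echelon_words d (Suc m) k.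
         length (letter_prefix d Y) = length (letter_prefix d Z) \<longrightarrow>
         g (letter_prefix d (map (substitute d Y) T)) = g (letter_prefix d (map (substitute d Z) T))"
    proof (rule bexI[OF _ T], intro allI ballI impI)
      fix k and Y Z :: "(nat \<Rightarrow> 'a) list"
      assume Y: "Y \<in> echelon_words d (Suc m) k" and Z: "Z \<in> echelon_words d (Suc m) k"
        and len: "length (letter_prefix d Y) = length (letter_prefix d Z)"
      from Y show "g (letter_prefix d (map (substitute d Y) T)) = g (letter_prefix d (map (substitute d Z) T))"
      proof (cases rule: echelon_words_SucE)
        case Y': (letter v Y')
        from Z show ?thesis
        proof (cases rule: echelon_words_SucE)
          case Z': (letter w Z')
          have "length (letter_prefix d Y') = length (letter_prefix d Z')"
            using len Y'(2) Z'(2) unfolding Y'(1) Z'(1) by simp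
          with Y'(3) Z'(3) show ?thesis
            unfolding Y'(1) Z'(1) letter[OF Y'(2,3)] letter[OF Z'(2,3)] by (rule T1_mono)
        next
          case Z': (pivot Z' k')
          with len Y'(2) show ?thesis unfolding Y'(1) by simp
        qed
      next
        case Y': (pivot Y' k')
        from Z show ?thesis
        proof (cases rule: echelon_words_SucE)
          case Z': (letter w Z')
          with len show ?thesis unfolding Y'(1) by simp
        next
          case Z': (pivot Z' k')
          show ?thesis unfolding Y'(1) Z'(1) pivot ..
        qed
      qed
    qed
  qed
qed

text \<open>
  For \<open>d = 0\<close>: whenever the \<open>k\<close>-dimensional subspaces of \<open>F\<^sup>n\<close> are coloured with \<open>r\<close> colours, some
  \<open>m\<close>-dimensional subspace has all its \<open>k\<close>-dimensional subspaces of one colour. For \<open>k = 0\<close> it is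
  a Hales--Jewett theorem for the alphabet \<open>F\<^sup>d\<close> with \<open>m\<close> variables. Induction on \<open>k\<close> needs all \<open>d\<close> at
  once, because lowering \<open>k\<close> raises \<open>d\<close>. The first argument only fixes the field.
\<close>

definition space_Ramsey :: "'a::field itself \<Rightarrow> nat \<Rightarrow> nat \<Rightarrow> nat \<Rightarrow> nat \<Rightarrow> nat \<Rightarrow> bool" where
  "space_Ramsey _ d k m r n \<longleftrightarrow>
     (\<forall>c :: (nat \<Rightarrow> 'a) list \<Rightarrow> nat. (\<forall>u. c u < r) \<longrightarrow>
       (\<exists>R\<in>echelon_words d n m. \<forall>Y\<in>echelon_words d m k. \<forall>Z\<in>echelon_words d m k.
          c (map (substitute d Y) R) = c (map (substitute d Z) R)))"

text \<open>
  Induction on the number \<open>M\<close> of parameters, where \<open>R\<close> begins with a pivot. If \<open>Y\<close> keeps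
  the first parameter, it becomes a constant and the rest of \<open>Y\<close> has \<open>k\<close> further parameters, so that \<open>IH\<close>
  for the alphabet \<open>F\<^sup>d\<^sup>+\<^sup>1\<close> makes the colour constant. If \<open>Y\<close> begins with a letter \<open>v\<close>, the
  induction hypothesis for \<open>M\<close> is applied to the colouring that records the colours for all letters \<open>v\<close>
  together; the resulting \<open>S\<close> does not involve the first parameter, hence serves all \<open>v\<close> at once
  and does not destroy what was achieved before.
\<close>

lemma colour_depends_on_letter_prefix:
  fixes d k M r :: nat
  assumes IH: "\<And>d m r. \<exists>n. space_Ramsey TYPE('a::{finite,field}) d k m r n"
  shows "\<exists>n. \<forall>c :: (nat \<Rightarrow> 'a) list \<Rightarrow> nat. (\<forall>u. c u < r) \<longrightarrow>
    (\<exists>R\<in>echelon_words d n M. \<forall>Y\<in>echelon_words d M (Suc k). \<forall>Z\<in>echelon_words d M (Suc k).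
       letter_prefix d Y = letter_prefix d Z \<longrightarrow>
       c (map (substitute d Y) R) = c (map (substitute d Z) R))"
proof (induction M arbitrary: r)
  case 0
  show ?case
    by (intro exI[of _ 0]) (auto simp: echelon_words_0)
next
  case (Suc M)
  have "finite {v :: nat \<Rightarrow> 'a. supported_below d v}" by (rule finite_supported_below)
  from product_colouring[OF this, of r] obtain s and \<phi> :: "((nat \<Rightarrow> 'a) \<Rightarrow> nat) \<Rightarrow> nat"
    where \<phi>s [rule_format]: "\<forall>f. (\<forall>p. f p < r) \<longrightarrow> \<phi> f < s"
      and \<phi> [rule_format]: "\<forall>f g. (\<forall>p. f p < r) \<longrightarrow> (\<forall>p. g p < r) \<longrightarrow> \<phi> f = \<phi> g \<longrightarrow>
                  (\<forall>p\<in>{v. supported_below d v}. f p = g p)" .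
  from Suc[of s] obtain N where N [THEN spec, THEN mp]: "\<forall>c :: (nat \<Rightarrow> 'a) list \<Rightarrow> nat. (\<forall>u. c u < s) \<longrightarrow>
    (\<exists>R\<in>echelon_words d N M. \<forall>Y\<in>echelon_words d M (Suc k). \<forall>Z\<in>echelon_words d M (Suc k).
       letter_prefix d Y = letter_prefix d Z \<longrightarrow>
       c (map (substitute d Y) R) = c (map (substitute d Z) R))"
    ..
  from IH[of "Suc d" N r] obtain n where n [THEN spec, THEN mp]: "\<forall>c :: (nat \<Rightarrow> 'a) list \<Rightarrow> nat. (\<forall>u. c u < r) \<longrightarrow>
       (\<exists>R\<in>echelon_words (Suc d) n N. \<forall>Y\<in>echelon_words (Suc d) N k. \<forall>Z\<in>echelon_words (Suc d) N k.
          c (map (substitute (Suc d) Y) R) = c (map (substitute (Suc d) Z) R))"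
    unfolding space_Ramsey_def ..
  show ?case
  proof (intro exI[of _ "Suc n"] allI impI)
    fix c :: "(nat \<Rightarrow> 'a) list \<Rightarrow> nat" assume c: "\<forall>u. c u < r"
    then have "\<forall>u. c (unit_fun d # u) < r" by simp
    from n[OF this] obtain R0 where R0: "R0 \<in> echelon_words (Suc d) n N"
      and R0_mono: "\<And>Y Z. Y \<in> echelon_words (Suc d) N k \<Longrightarrow> Z \<in> echelon_words (Suc d) N k \<Longrightarrow>
          c (unit_fun d # map (substitute (Suc d) Y) R0) = c (unit_fun d # map (substitute (Suc d) Z) R0)"
      by blast
    define R1 where "R1 = unit_fun d # R0"
    have R1: "R1 \<in> echelon_words d (Suc n) (Suc N)"
      using R0 by (simp add: R1_def Cons_in_echelon_words)
    have "\<forall>Y. \<phi> (\<lambda>v. c (map (substitute d (v # Y)) R1)) < s" using \<phi>s c by simp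
    from N[OF this] obtain S where S: "S \<in> echelon_words d N M"
      and S_mono: "\<And>Y Z. Y \<in> echelon_words d M (Suc k) \<Longrightarrow> Z \<in> echelon_words d M (Suc k) \<Longrightarrow>
       letter_prefix d Y = letter_prefix d Z \<Longrightarrow>
       \<phi> (\<lambda>v. c (map (substitute d (v # map (substitute d Y) S)) R1))
         = \<phi> (\<lambda>v. c (map (substitute d (v # map (substitute d Z) S)) R1))"
      by blast
    define Q where "Q = unit_fun d # map (insert_column d) S"
    have Q: "Q \<in> echelon_words d (Suc N) (Suc M)"
      using insert_column_in_echelon_words[OF S] by (simp add: Q_def Cons_in_echelon_words)
    define R where "R = map (substitute d Q) R1"
    have R: "R \<in> echelon_words d (Suc n) (Suc M)"
      unfolding R_def by (rule substitute_in_echelon_words[OF R1 Q])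
    have subst_R: "map (substitute d Y) R = map (substitute d (map (substitute d Y) Q)) R1" for Y
      unfolding R_def by (rule map_substitute_substitute)
    have letter: "map (substitute d (v # Y)) Q = v # map (substitute d Y) S" for v Y
      by (simp add: Q_def)
    have pivot: "\<exists>y\<in>echelon_words (Suc d) N k. map (substitute d (unit_fun d # Y)) R
        = unit_fun d # map (substitute (Suc d) y) R0" if "Y \<in> echelon_words (Suc d) M k" for Y
    proof
      let ?y = "map (substitute (Suc d) Y) (map (insert_column d) S)"
      show "?y \<in> echelon_words (Suc d) N k"
        using insert_column_in_echelon_words[OF S] that by (rule substitute_in_echelon_words)
      have "map (substitute d (unit_fun d # Y)) Q = unit_fun d # ?y"
        by (simp add: Q_def flip: substitute_Cons_unit)
      then show "map (substitute d (unit_fun d # Y)) R = unit_fun d # map (substitute (Suc d) ?y) R0"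
        by (simp add: subst_R R1_def substitute_Cons_unit)
    qed
    show "\<exists>R\<in>echelon_words d (Suc n) (Suc M).
       \<forall>Y\<in>echelon_words d (Suc M) (Suc k). \<forall>Z\<in>echelon_words d (Suc M) (Suc k).
       letter_prefix d Y = letter_prefix d Z \<longrightarrow>
       c (map (substitute d Y) R) = c (map (substitute d Z) R)"
    proof (rule bexI[OF _ R], intro ballI impI)
      fix Y Z :: "(nat \<Rightarrow> 'a) list"
      assume Y: "Y \<in> echelon_words d (Suc M) (Suc k)" and Z: "Z \<in> echelon_words d (Suc M) (Suc k)"
        and eq: "letter_prefix d Y = letter_prefix d Z"
      from Y show "c (map (substitute d Y) R) = c (map (substitute d Z) R)"
      proof (cases rule: echelon_words_SucE)
        case Y': (letter v Y')
        from Z show ?thesis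
        proof (cases rule: echelon_words_SucE)
          case Z': (letter w Z')
          have "w = v" "letter_prefix d Y' = letter_prefix d Z'"
            using eq Y'(2) Z'(2) unfolding Y'(1) Z'(1) by simp_all
          have "c (map (substitute d (v # map (substitute d Y') S)) R1)
              = c (map (substitute d (v # map (substitute d Z') S)) R1)"
            by (rule \<phi>[OF _ _ S_mono]) (use Y' Z' c \<open>letter_prefix d Y' = letter_prefix d Z'\<close> in auto)
          then show ?thesis unfolding Y'(1) Z'(1) \<open>w = v\<close> subst_R letter .
        next
          case Z': (pivot Z' k')
          with eq Y'(2) show ?thesis unfolding Y'(1) by simp
        qed
      next
        case Y': (pivot Y' k')
        from Z show ?thesis
        proof (cases rule: echelon_words_SucE)
          case Z': (pivot Z' k'')
          from Y' Z' have "Y' \<in> echelon_words (Suc d) M k" "Z' \<in> echelon_words (Suc d) M k"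
            by simp_all
          note Y_pivot = this(1) and Z_pivot = this(2)
          obtain y where y: "y \<in> echelon_words (Suc d) N k"
              "map (substitute d Y) R = unit_fun d # map (substitute (Suc d) y) R0"
            unfolding Y'(1) using pivot[OF Y_pivot] ..
          obtain z where z: "z \<in> echelon_words (Suc d) N k"
              "map (substitute d Z) R = unit_fun d # map (substitute (Suc d) z) R0"
            unfolding Z'(1) using pivot[OF Z_pivot] ..
          show ?thesis unfolding y(2) z(2) by (rule R0_mono[OF y(1) z(1)])
        next
          case Z': (letter w Z')
          with eq show ?thesis unfolding Y'(1) by simp
        qed
      qed
    qed
  qed
qed

text \<open>
  The word \<open>U\<close> has its parameters at the positions in \<open>S\<close> and zero letters elsewhere. Substitution turns
  some of these parameters into letters and keeps the first pivot at one of the positions.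
\<close>

lemma select_positions:
  fixes S :: "nat set"
  assumes "S \<subseteq> {..<M}"
  shows "\<exists>U\<in>echelon_words d M (card S). \<forall>k. \<forall>Y\<in>echelon_words d (card S) (Suc k).
     length (letter_prefix d (map (substitute d Y) (U :: (nat \<Rightarrow> 'a::field) list))) \<in> S"
  using assms
proof (induction M arbitrary: S)
  case 0
  then show ?case by (auto simp: echelon_words_0)
next
  case (Suc M)
  define S' where "S' = {i. Suc i \<in> S}"
  have "S' \<subseteq> {..<M}" using Suc.prems by (auto simp: S'_def)
  from Suc.IH[OF this] obtain U :: "(nat \<Rightarrow> 'a) list"
    where U: "U \<in> echelon_words d M (card S')"
      and sel: "\<And>k Y. Y \<in> echelon_words d (card S') (Suc k) \<Longrightarrow>
        length (letter_prefix d (map (substitute d Y) U)) \<in> S'" by blast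
  have fin: "finite S'" using \<open>S' \<subseteq> {..<M}\<close> finite_subset by blast
  have S_cases: "S = Suc ` S' \<union> (S \<inter> {0})"
  proof -
    have "i \<in> Suc ` S' \<or> i = 0" if "i \<in> S" for i
      using that by (cases i) (auto simp: S'_def)
    then show ?thesis by (auto simp: S'_def)
  qed
  show ?case
  proof (cases "0 \<in> S")
    case True
    then have "S = insert 0 (Suc ` S')" using S_cases by auto
    then have card: "card S = Suc (card S')"
      using fin by (simp add: card_insert_if card_image)
    let ?U = "unit_fun d # map (insert_column d) U"
    have "?U \<in> echelon_words d (Suc M) (card S)"
      using insert_column_in_echelon_words[OF U] by (simp add: card Cons_in_echelon_words)
    moreover have "length (letter_prefix d (map (substitute d Y) ?U)) \<in> S"
      if "Y \<in> echelon_words d (card S) (Suc k)" for Y k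
      using that unfolding card
    proof (cases rule: echelon_words_SucE)
      case (letter v Y')
      then show ?thesis using sel[of Y' k] by (auto simp: S'_def o_def)
    qed (use True in auto)
    ultimately show ?thesis by blast
  next
    case False
    then have "S = Suc ` S'" using S_cases by auto
    then have card: "card S = card S'" by (simp add: card_image)
    have "(\<lambda>_. 0) # U \<in> echelon_words d (Suc M) (card S)"
      using U by (simp add: card Cons_in_echelon_words)
    moreover have "length (letter_prefix d (map (substitute d Y) ((\<lambda>_. 0) # U))) \<in> S"
      if "Y \<in> echelon_words d (card S) (Suc k)" for Y k
      using that sel[of Y k] by (simp add: card S'_def)
    ultimately show ?thesis by blast
  qed
qed

lemma large_colour_class:
  fixes f :: "nat \<Rightarrow> nat"
  assumes "\<forall>i. f i < r"
  shows "\<exists>S\<subseteq>{..<r * m}. card S = m \<and> (\<forall>i\<in>S. \<forall>j\<in>S. f i = f j)"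
proof (cases "m = 0")
  case True
  then show ?thesis by auto
next
  case False
  have "r > 0" using assms by (metis gr_zeroI not_less_zero)
  have "\<exists>y\<in>{..<r}. card (f -` {y} \<inter> {..<r * m}) * card {..<r} \<ge> card {..<r * m}"
    by (rule pigeonhole_card) (use assms \<open>r > 0\<close> in auto)
  then obtain y where "m \<le> card (f -` {y} \<inter> {..<r * m})"
    using \<open>r > 0\<close> by (auto simp: mult.commute)
  then obtain S where "S \<subseteq> f -` {y} \<inter> {..<r * m}" "card S = m"
    by (meson obtain_subset_with_card_n)
  then show ?thesis by (intro exI[of _ S]) auto
qed

text \<open>
  For \<open>k = 0\<close> a word is its own letter prefix, and \<open>colour_depends_on_prefix_length\<close> is the claim. In
  the inductive step three substitutions are composed: after \<open>R\<close> the colour is a function \<open>g\<close> of the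
  letter prefix, after \<open>T\<close> a function \<open>f\<close> of its length, and \<open>U\<close> confines this length to a set on which
  \<open>f\<close> is constant. Then \<open>r * m\<close> positions suffice for \<open>m\<close> of them to share a colour.
\<close>

theorem Graham_Leeb_Rothschild:
  fixes d k m r :: nat
  shows "\<exists>n. space_Ramsey TYPE('a::{finite,field}) d k m r n"
proof (induction k arbitrary: d m r)
  case 0
  obtain M where M [THEN spec, THEN mp]: "\<forall>g :: (nat \<Rightarrow> 'a) list \<Rightarrow> nat. (\<forall>u. g u < r) \<longrightarrow>
    (\<exists>T\<in>echelon_words d M m. \<forall>k. \<forall>Y\<in>echelon_words d m k. \<forall>Z\<in>echelon_words d m k.
       length (letter_prefix d Y) = length (letter_prefix d Z) \<longrightarrow>
       g (letter_prefix d (map (substitute d Y) T)) = g (letter_prefix d (map (substitute d Z) T)))"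
    using colour_depends_on_prefix_length[of r d m] ..
  have whole: "letter_prefix d Y = Y" if "Y \<in> echelon_words d n 0" for Y :: "(nat \<Rightarrow> 'a) list" and n
    using that by (simp add: echelon_words_def echelon_letters_iff takeWhile_eq_all_conv)
  have "space_Ramsey TYPE('a) d 0 m r M"
    unfolding space_Ramsey_def
  proof (intro allI impI)
    fix c :: "(nat \<Rightarrow> 'a) list \<Rightarrow> nat" assume "\<forall>u. c u < r"
    from M[OF this] obtain T where T: "T \<in> echelon_words d M m"
      and mono: "\<And>k Y Z. Y \<in> echelon_words d m k \<Longrightarrow> Z \<in> echelon_words d m k \<Longrightarrow>
       length (letter_prefix d Y) = length (letter_prefix d Z) \<Longrightarrow>
       c (letter_prefix d (map (substitute d Y) T)) = c (letter_prefix d (map (substitute d Z) T))"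
      by blast
    have "c (map (substitute d Y) T) = c (map (substitute d Z) T)"
      if "Y \<in> echelon_words d m 0" "Z \<in> echelon_words d m 0" for Y Z
      using mono[OF that] whole[OF that(1)] whole[OF that(2)] that
        whole[OF substitute_in_echelon_words[OF T that(1)]]
        whole[OF substitute_in_echelon_words[OF T that(2)]]
      by (simp add: echelon_words_def)
    with T show "\<exists>R\<in>echelon_words d M m. \<forall>Y\<in>echelon_words d m 0. \<forall>Z\<in>echelon_words d m 0.
          c (map (substitute d Y) R) = c (map (substitute d Z) R)" by blast
  qed
  then show ?case by blast
next
  case (Suc k)
  obtain M where M [THEN spec, THEN mp]: "\<forall>g :: (nat \<Rightarrow> 'a) list \<Rightarrow> nat. (\<forall>u. g u < r) \<longrightarrow>
    (\<exists>T\<in>echelon_words d M (r * m).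
       \<forall>k. \<forall>Y\<in>echelon_words d (r * m) k. \<forall>Z\<in>echelon_words d (r * m) k.
       length (letter_prefix d Y) = length (letter_prefix d Z) \<longrightarrow>
       g (letter_prefix d (map (substitute d Y) T)) = g (letter_prefix d (map (substitute d Z) T)))"
    using colour_depends_on_prefix_length[of r d "r * m"] ..
  obtain n where n [THEN spec, THEN mp]: "\<forall>c :: (nat \<Rightarrow> 'a) list \<Rightarrow> nat. (\<forall>u. c u < r) \<longrightarrow>
    (\<exists>R\<in>echelon_words d n M. \<forall>Y\<in>echelon_words d M (Suc k). \<forall>Z\<in>echelon_words d M (Suc k).
       letter_prefix d Y = letter_prefix d Z \<longrightarrow>
       c (map (substitute d Y) R) = c (map (substitute d Z) R))"
    using colour_depends_on_letter_prefix[OF Suc, of r d M] ..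
  have "space_Ramsey TYPE('a) d (Suc k) m r n"
    unfolding space_Ramsey_def
  proof (intro allI impI)
    fix c :: "(nat \<Rightarrow> 'a) list \<Rightarrow> nat" assume c: "\<forall>u. c u < r"
    from n[OF c] obtain R where R: "R \<in> echelon_words d n M"
      and R_mono: "\<And>Y Z. Y \<in> echelon_words d M (Suc k) \<Longrightarrow> Z \<in> echelon_words d M (Suc k) \<Longrightarrow>
       letter_prefix d Y = letter_prefix d Z \<Longrightarrow>
       c (map (substitute d Y) R) = c (map (substitute d Z) R)" by blast
    define g where "g w = c (map (substitute d
        (SOME Y. Y \<in> echelon_words d M (Suc k) \<and> letter_prefix d Y = w)) R)" for w
    have g: "g (letter_prefix d Y) = c (map (substitute d Y) R)"
      if "Y \<in> echelon_words d M (Suc k)" for Y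
    proof -
      have "\<exists>Z. Z \<in> echelon_words d M (Suc k) \<and> letter_prefix d Z = letter_prefix d Y"
        using that by blast
      from someI_ex[OF this] show ?thesis unfolding g_def by (intro R_mono) (use that in simp_all)
    qed
    have "\<forall>w. g w < r" using c by (simp add: g_def)
    from M[OF this] obtain T where T: "T \<in> echelon_words d M (r * m)"
      and T_mono: "\<And>k Y Z. Y \<in> echelon_words d (r * m) k \<Longrightarrow> Z \<in> echelon_words d (r * m) k \<Longrightarrow>
       length (letter_prefix d Y) = length (letter_prefix d Z) \<Longrightarrow>
       g (letter_prefix d (map (substitute d Y) T)) = g (letter_prefix d (map (substitute d Z) T))"
      by blast
    define f where "f i = g (letter_prefix d (map (substitute d
        (SOME Y. Y \<in> echelon_words d (r * m) (Suc k) \<and> length (letter_prefix d Y) = i)) T))" for i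
    have f: "f (length (letter_prefix d Y)) = g (letter_prefix d (map (substitute d Y) T))"
      if "Y \<in> echelon_words d (r * m) (Suc k)" for Y
    proof -
      have "\<exists>Z :: (nat \<Rightarrow> 'a) list. Z \<in> echelon_words d (r * m) (Suc k)
          \<and> length (letter_prefix d Z) = length (letter_prefix d Y)"
        using that by (intro exI[of _ Y] conjI refl)
      from someI_ex[OF this] show ?thesis unfolding f_def by (intro T_mono) (use that in simp_all)
    qed
    have "\<forall>i. f i < r" using \<open>\<forall>w. g w < r\<close> by (simp add: f_def)
    from large_colour_class[OF this, of m] obtain S where S: "S \<subseteq> {..<r * m}" "card S = m"
      and S_mono: "\<And>i j. i \<in> S \<Longrightarrow> j \<in> S \<Longrightarrow> f i = f j" by blast
    from select_positions[OF S(1), of d] obtain U :: "(nat \<Rightarrow> 'a) list"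
      where U: "U \<in> echelon_words d (r * m) m"
        and sel: "\<And>Y. Y \<in> echelon_words d m (Suc k) \<Longrightarrow>
          length (letter_prefix d (map (substitute d Y) U)) \<in> S" unfolding S(2) by blast
    define R' where "R' = map (substitute d (map (substitute d U) T)) R"
    have "R' \<in> echelon_words d n m"
      unfolding R'_def by (intro substitute_in_echelon_words[OF R] substitute_in_echelon_words[OF T] U)
    moreover have colour: "c (map (substitute d Y) R') = f (length (letter_prefix d (map (substitute d Y) U)))"
      if Y: "Y \<in> echelon_words d m (Suc k)" for Y
    proof -
      have UY: "map (substitute d Y) U \<in> echelon_words d (r * m) (Suc k)"
        using U Y by (rule substitute_in_echelon_words)
      have TUY: "map (substitute d (map (substitute d Y) U)) T \<in> echelon_words d M (Suc k)"
        using T UY by (rule substitute_in_echelon_words)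
      have "map (substitute d Y) R' = map (substitute d (map (substitute d (map (substitute d Y) U)) T)) R"
        unfolding R'_def map_substitute_substitute ..
      then show ?thesis using g[OF TUY] f[OF UY] by simp
    qed
    moreover have "c (map (substitute d Y) R') = c (map (substitute d Z) R')"
      if "Y \<in> echelon_words d m (Suc k)" "Z \<in> echelon_words d m (Suc k)" for Y Z
      using that colour S_mono sel by simp
    ultimately show "\<exists>R\<in>echelon_words d n m.
        \<forall>Y\<in>echelon_words d m (Suc k). \<forall>Z\<in>echelon_words d m (Suc k).
          c (map (substitute d Y) R) = c (map (substitute d Z) R)" by blast
  qed
  then show ?case by blast
qed

section \<open>Echelon words as the rows of matrices\<close>

definition word_matrix :: "nat \<Rightarrow> (nat \<Rightarrow> 'a::field) list \<Rightarrow> 'a mat" where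
  "word_matrix k xs = mat (length xs) k (\<lambda>(i, j). (xs ! i) j)"

lemma word_matrix_carrier [simp]:
  "dim_row (word_matrix k xs) = length xs" "dim_col (word_matrix k xs) = k"
  "word_matrix k xs \<in> carrier_mat (length xs) k"
  by (auto simp: word_matrix_def)

lemma word_matrix_in_carrier: "xs \<in> echelon_words d n m \<Longrightarrow> word_matrix k xs \<in> carrier_mat n k"
  by (auto simp: echelon_words_def)

lemma word_matrix_substitute:
  "word_matrix k (map (substitute 0 Y) R) = word_matrix (length Y) R * word_matrix k Y"
  by (rule eq_matI) (auto simp: word_matrix_def substitute_def scalar_prod_def atLeast0LessThan)

lemma word_matrix_inj:
  assumes "word_matrix k xs = word_matrix k ys"
    and "\<forall>v\<in>set xs. supported_below k v" "\<forall>v\<in>set ys. supported_below k v"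
  shows "xs = ys"
proof (rule nth_equalityI)
  show len: "length xs = length ys"
    using arg_cong[OF assms(1), of dim_row] by simp
  fix i assume i: "i < length xs"
  show "xs ! i = ys ! i"
  proof
    fix j
    show "(xs ! i) j = (ys ! i) j"
    proof (cases "j < k")
      case True
      then show ?thesis
        using arg_cong[OF assms(1), of "\<lambda>A. A $$ (i, j)"] i len by (simp add: word_matrix_def)
    next
      case False
      have "supported_below k (xs ! i)" using assms(2) nth_mem[OF i] by blast
      moreover have "supported_below k (ys ! i)" using assms(3) nth_mem[of i ys] i len by auto
      ultimately show ?thesis using False by (simp add: supported_below_def)
    qed
  qed
qed

text \<open>
  Zeros beyond the last column make the rows supported vectors, so that this is inverse to \<open>word_matrix\<close>.
\<close>

definition matrix_rows :: "'a::field mat \<Rightarrow> (nat \<Rightarrow> 'a) list" where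
  "matrix_rows A = map (\<lambda>i j. if j < dim_col A then A $$ (i, j) else 0) [0..<dim_row A]"

lemma matrix_rows [simp]:
  "length (matrix_rows A) = dim_row A"
  "v \<in> set (matrix_rows A) \<Longrightarrow> supported_below (dim_col A) v"
  "word_matrix (dim_col A) (matrix_rows A) = A"
  by (auto simp: matrix_rows_def supported_below_def word_matrix_def)

text \<open>
  For \<open>d = 0\<close>, the definition of RREF for the transpose, expressed through rows: \<open>p i\<close> is the position of the \<open>i\<close>-th pivot,
  and the rows above it are combinations of the first \<open>i\<close> unit vectors. This is the link between the
  recursive \<open>echelon\<close> and \<open>rref\<close>.
\<close>

definition pivots :: "nat \<Rightarrow> (nat \<Rightarrow> 'a::field) list \<Rightarrow> nat \<Rightarrow> (nat \<Rightarrow> nat) \<Rightarrow> bool" where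
  "pivots d xs k p \<longleftrightarrow> d \<le> k \<and> (\<forall>v\<in>set xs. supported_below k v) \<and> strict_mono_on {d..<k} p \<and>
     (\<forall>i\<in>{d..<k}. p i < length xs \<and> xs ! p i = unit_fun i \<and> (\<forall>l<p i. supported_below i (xs ! l)))"

lemma echelon_imp_pivots: "echelon d xs k \<Longrightarrow> \<exists>p. pivots d xs k p"
proof (induction xs arbitrary: d)
  case Nil
  then show ?case by (auto simp: pivots_def strict_mono_on_def)
next
  case (Cons v xs)
  have supp: "\<forall>v\<in>set (v # xs). supported_below k v" and "d \<le> k"
    using Cons.prems echelon_imp_supported echelon_le by blast+
  consider "supported_below d v" "echelon d xs k" | "v = unit_fun d" "echelon (Suc d) xs k"
    using Cons.prems by auto
  then show ?case
  proof cases
    case 1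
    then obtain p where p: "pivots d xs k p" using Cons.IH by blast
    have "supported_below i ((v # xs) ! l)" if "i \<in> {d..<k}" "l < Suc (p i)" for i l
      using p that supported_below_mono[OF 1(1), of i] by (cases l) (auto simp: pivots_def)
    then have "pivots d (v # xs) k (\<lambda>i. Suc (p i))"
      using p supp by (auto simp: pivots_def strict_mono_on_def)
    then show ?thesis by blast
  next
    case 2
    then obtain p where p: "pivots (Suc d) xs k p" using Cons.IH by blast
    let ?p = "\<lambda>i. if i = d then 0 else Suc (p i)"
    have below: "supported_below i ((v # xs) ! l)" if "i \<in> {d..<k}" "l < ?p i" for i l
      using p that 2(1) supported_below_unit_fun[of d i] by (cases l) (auto simp: pivots_def split: if_splits)
    have "d < k" using echelon_le[OF 2(2)] by simp
    have at: "?p i < length (v # xs) \<and> (v # xs) ! ?p i = unit_fun i" if "i \<in> {d..<k}" for i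
      using p 2(1) that by (auto simp: pivots_def)
    have "strict_mono_on {d..<k} ?p"
      using p unfolding pivots_def strict_mono_on_def by auto
    then have "pivots d (v # xs) k ?p"
      unfolding pivots_def using \<open>d \<le> k\<close> supp at below by blast
    then show ?thesis by blast
  qed
qed

lemma pivots_imp_echelon: "pivots d xs k p \<Longrightarrow> echelon d xs k"
proof (induction xs arbitrary: d p)
  case Nil
  then have "{d..<k} = {}" by (auto simp: pivots_def)
  then show ?case using Nil by (auto simp: pivots_def)
next
  case (Cons v xs)
  show ?case
  proof (cases "d = k")
    case True
    then show ?thesis using Cons.prems unfolding echelon_letters_iff[of k "v # xs"] True
      by (simp add: pivots_def echelon_letters_iff)
  next
    case False
    then have dk: "d < k" using Cons.prems by (simp add: pivots_def)
    have mono: "p i < p j" if "d \<le> i" "i < j" "j < k" for i j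
      using Cons.prems that by (auto simp: pivots_def strict_mono_on_def)
    have at: "p i < Suc (length xs)" "(v # xs) ! p i = unit_fun i" if "d \<le> i" "i < k" for i
      using Cons.prems that by (auto simp: pivots_def)
    have below: "supported_below i ((v # xs) ! l)" if "d \<le> i" "i < k" "l < p i" for i l
      using Cons.prems that by (auto simp: pivots_def)
    have shift: "pivots d' xs k (\<lambda>i. p i - 1)" if d': "d \<le> d'" "d' \<le> k" "d' < k \<longrightarrow> 0 < p d'" for d'
    proof -
      have pos: "0 < p i" if "d' \<le> i" "i < k" for i
        using that d' mono[of d' i] by (cases "i = d'") auto
      have "strict_mono_on {d'..<k} (\<lambda>i. p i - 1)"
      proof (rule strict_mono_onI)
        fix i j assume "i \<in> {d'..<k}" "j \<in> {d'..<k}" "i < j"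
        then show "p i - 1 < p j - 1" using mono[of i j] pos[of i] d' by auto
      qed
      moreover have "p i - 1 < length xs \<and> xs ! (p i - 1) = unit_fun i \<and>
          (\<forall>l<p i - 1. supported_below i (xs ! l))" if "i \<in> {d'..<k}" for i
      proof (intro conjI allI impI)
        have i: "d \<le> i" "i < k" using that d' by auto
        have pos': "p i = Suc (p i - 1)" using pos[of i] that by auto
        show "p i - 1 < length xs" using at(1)[OF i] pos' by linarith
        show "xs ! (p i - 1) = unit_fun i" using at(2)[OF i] pos' by (metis nth_Cons_Suc)
        fix l assume "l < p i - 1"
        then show "supported_below i (xs ! l)" using below[OF i, of "Suc l"] by simp
      qed
      ultimately show ?thesis using Cons.prems d'(2) by (simp add: pivots_def)
    qed
    show ?thesis
    proof (cases "p d = 0")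
      case True
      then have "v = unit_fun d" using at(2)[of d] dk by simp
      moreover have "echelon (Suc d) xs k"
        by (rule Cons.IH, rule shift) (use dk mono[of d "Suc d"] in auto)
      ultimately show ?thesis by simp
    next
      case False
      then have "supported_below d v" using below[of d 0] dk by simp
      moreover have "echelon d xs k"
        by (rule Cons.IH, rule shift) (use dk False in auto)
      ultimately show ?thesis by simp
    qed
  qed
qed

text \<open>
  The left inverse selects the pivot rows, which form an identity matrix.
\<close>

lemma word_matrix_left_inverse:
  assumes "echelon 0 xs k"
  obtains L where "L \<in> carrier_mat k (length xs)" "L * word_matrix k xs = 1\<^sub>m k"
proof -
  obtain p where p: "pivots 0 xs k p" using echelon_imp_pivots[OF assms] ..
  define L where "L = mat k (length xs) (\<lambda>(i, l). if l = p i then 1 else 0 :: 'a)"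
  show thesis
  proof (rule that)
    show "L \<in> carrier_mat k (length xs)" by (simp add: L_def)
    show "L * word_matrix k xs = 1\<^sub>m k"
    proof (rule eq_matI)
      fix i j assume "i < dim_row (1\<^sub>m k :: 'a mat)" "j < dim_col (1\<^sub>m k :: 'a mat)"
      then have ij: "i < k" "j < k" by auto
      then have "p i < length xs" "xs ! p i = unit_fun i" using p by (auto simp: pivots_def)
      then show "(L * word_matrix k xs) $$ (i, j) = 1\<^sub>m k $$ (i, j)"
        using ij by (auto simp: L_def word_matrix_def scalar_prod_def unit_fun_def
            if_distrib[of "\<lambda>t. t * _"] cong: if_cong)
    qed (auto simp: L_def)
  qed
qed

section \<open>Rank\<close>

definition trivial_kernel :: "'a::field mat \<Rightarrow> bool" where
  "trivial_kernel D \<longleftrightarrow>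
     (\<forall>v\<in>carrier_vec (dim_col D). D *\<^sub>v v = 0\<^sub>v (dim_row D) \<longrightarrow> v = 0\<^sub>v (dim_col D))"

lemma trivial_kernelD:
  "trivial_kernel D \<Longrightarrow> D \<in> carrier_mat a b \<Longrightarrow> v \<in> carrier_vec b \<Longrightarrow> D *\<^sub>v v = 0\<^sub>v a \<Longrightarrow> v = 0\<^sub>v b"
  by (auto simp: trivial_kernel_def)

lemma mult_unit_vec:
  fixes A :: "'a::field mat"
  assumes "A \<in> carrier_mat n k" "j < k"
  shows "A *\<^sub>v unit_vec k j = col A j"
  using assms by (intro eq_vecI) (auto simp: scalar_prod_right_unit)

lemma cols_independent:
  fixes D :: "'a::field mat"
  assumes D: "D \<in> carrier_mat a b"
    and triv: "trivial_kernel D"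
  shows "distinct (cols D)"
    and "module.lin_indpt class_ring (module_vec TYPE('a) a) (set (cols D))"
proof -
  interpret vec_space "TYPE('a)" a .
  note ker = trivial_kernelD[OF triv D]
  show dist: "distinct (cols D)"
    unfolding distinct_conv_nth
  proof (intro allI impI)
    fix i j assume "i < length (cols D)" "j < length (cols D)" "i \<noteq> j"
    then have ij: "i < b" "j < b" "i \<noteq> j" using D by auto
    show "cols D ! i \<noteq> cols D ! j"
    proof
      assume eq: "cols D ! i = cols D ! j"
      have "D *\<^sub>v (unit_vec b i - unit_vec b j) = D *\<^sub>v unit_vec b i - D *\<^sub>v unit_vec b j"
        using D by (intro mult_minus_distrib_mat_vec) auto
      also have "\<dots> = 0\<^sub>v a"
        using eq ij D by (simp add: mult_unit_vec)
      finally have "unit_vec b i - unit_vec b j = (0\<^sub>v b :: 'a vec)" by (intro ker) auto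
      then have "(unit_vec b i - unit_vec b j :: 'a vec) $ i = 0" using ij by simp
      then show False using ij by simp
    qed
  qed
  show "lin_indpt (set (cols D))"
    using lin_depE[OF D _ dist] ker by blast
qed

lemma trivial_kernel_imp_le:
  fixes D :: "'a::field mat"
  assumes D: "D \<in> carrier_mat a b"
    and ker: "trivial_kernel D"
  shows "b \<le> a"
proof -
  interpret vec_space "TYPE('a)" a .
  note indep = cols_independent[OF D ker]
  have "card (set (cols D)) \<le> dim"
    using li_le_dim(2)[OF fin_dim _ indep(2)] cols_dim[of D] D by auto
  then show ?thesis using distinct_card[OF indep(1)] D by (simp add: dim_is_n)
qed

lemma left_inverse_imp_trivial_kernel:
  fixes D :: "'a::field mat"
  assumes "D \<in> carrier_mat a b" "L \<in> carrier_mat b a" "L * D = 1\<^sub>m b"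
  shows "trivial_kernel D"
  unfolding trivial_kernel_def
proof (intro ballI impI)
  fix v assume v: "v \<in> carrier_vec (dim_col D)" "D *\<^sub>v v = 0\<^sub>v (dim_row D)"
  then have v': "v \<in> carrier_vec b" using assms by simp
  have "v = (L * D) *\<^sub>v v" using assms v' by simp
  also have "\<dots> = L *\<^sub>v (D *\<^sub>v v)" using assms v' by (intro assoc_mult_mat_vec) auto
  also have "\<dots> = 0\<^sub>v b" using assms v by (auto intro!: eq_vecI)
  finally show "v = 0\<^sub>v (dim_col D)" using assms by simp
qed

text \<open>
  A right inverse of \<open>Y\<close> shows that \<open>X * Y\<close> has the same column space as \<open>X\<close>, and a left inverse of \<open>X\<close>
  makes the columns of \<open>X\<close> independent.
\<close>

lemma rank_full_factorisation:
  fixes X Y :: "'a::field mat"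
  assumes X: "X \<in> carrier_mat n k" and Y: "Y \<in> carrier_mat k q"
    and L: "L \<in> carrier_mat k n" "L * X = 1\<^sub>m k"
    and P: "P \<in> carrier_mat q k" "Y * P = 1\<^sub>m k"
  shows "vec_space.rank n (X * Y) = k"
proof -
  interpret vec_space "TYPE('a)" n .
  have "rank X = k"
    using cols_independent[OF X left_inverse_imp_trivial_kernel[OF X L]]
    by (intro lin_indpt_full_rank[OF X])
  moreover have "col_space (X * Y) = col_space X"
  proof (intro equalityI subsetI)
    fix y assume "y \<in> col_space (X * Y)"
    then obtain x where x: "x \<in> carrier_vec q" "(X * Y) *\<^sub>v x = y"
      using X Y by (auto simp: col_space_eq[of _ q] col_space_eq[OF mult_carrier_mat[OF X Y]])
    then have "X *\<^sub>v (Y *\<^sub>v x) = y" using X Y by (simp add: assoc_mult_mat_vec)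
    then show "y \<in> col_space X" using X Y x(1) by (auto simp: col_space_eq[OF X])
  next
    fix y assume "y \<in> col_space X"
    then obtain x where x: "x \<in> carrier_vec k" "X *\<^sub>v x = y"
      using X by (auto simp: col_space_eq[OF X])
    have "(X * Y) *\<^sub>v (P *\<^sub>v x) = X *\<^sub>v ((Y * P) *\<^sub>v x)"
      using X Y P(1) x(1) by (simp add: assoc_mult_mat_vec)
    also have "\<dots> = y" using x P(2) by simp
    finally have "(X * Y) *\<^sub>v (P *\<^sub>v x) = y" .
    then show "y \<in> col_space (X * Y)"
      using X Y P(1) x by (auto simp: col_space_eq[OF mult_carrier_mat[OF X Y]])
  qed
  then have "rank (X * Y) = rank X" by (simp add: rank_def col_space_def)
  ultimately show ?thesis by simp
qed

lemma GL_inverse: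
  fixes T :: "'a::field mat"
  assumes "T \<in> GL k"
  obtains S where "S \<in> carrier_mat k k" "S * T = 1\<^sub>m k" "T * S = 1\<^sub>m k"
proof -
  from assms obtain S where T: "T \<in> carrier_mat k k" and S: "T * S = 1\<^sub>m (dim_row T)" "S * T = 1\<^sub>m (dim_row S)"
    unfolding GL_def invertible_mat_def inverts_mat_def by auto
  have "dim_col S = k" using arg_cong[OF S(1), of dim_col] T by simp
  moreover have "dim_row S = k" using arg_cong[OF S(2), of dim_col] T by simp
  ultimately show thesis using that[of S] S T by auto
qed

lemma GL_I:
  fixes T :: "'a::field mat"
  assumes T: "T \<in> carrier_mat k k" and "S \<in> carrier_mat k k" "S * T = 1\<^sub>m k"
  shows "T \<in> GL k"
proof -
  have "T * S = 1\<^sub>m k" using mat_mult_left_right_inverse[OF assms(2,1,3)] .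
  then show ?thesis using assms by (auto simp: GL_def invertible_mat_def inverts_mat_def)
qed

lemma GL_transpose:
  fixes U :: "'a::field mat"
  assumes U: "U \<in> GL k"
  shows "U\<^sup>T \<in> GL k"
proof -
  obtain V where V: "V \<in> carrier_mat k k" "U * V = 1\<^sub>m k" using GL_inverse[OF U] .
  have Uc: "U \<in> carrier_mat k k" using U by (simp add: GL_def)
  have "V\<^sup>T * U\<^sup>T = 1\<^sub>m k" using transpose_mult[OF Uc V(1)] V(2) by simp
  then show ?thesis using Uc V(1) by (intro GL_I[of _ _ "V\<^sup>T"]) auto
qed

lemma trivial_kernels_imp_GL:
  fixes D :: "'a::field mat"
  assumes D: "D \<in> carrier_mat a b" and ker: "trivial_kernel D" and ker': "trivial_kernel D\<^sup>T"
  shows "a = b" "D \<in> GL b"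
proof -
  show "a = b"
    using trivial_kernel_imp_le[OF D ker] trivial_kernel_imp_le[of "D\<^sup>T" b a, OF _ ker'] D by force
  with D have D': "D \<in> carrier_mat b b" by simp
  have "det D \<noteq> 0"
    unfolding det_0_iff_vec_prod_zero_field[OF D'] using trivial_kernelD[OF ker D'] by blast
  from det_non_zero_imp_unit[OF D' this, of "()"] obtain S
    where "S \<in> carrier_mat b b" "S * D = 1\<^sub>m b" unfolding Units_def ring_mat_def by auto
  with D' show "D \<in> GL b" by (rule GL_I)
qed

section \<open>Factorisation\<close>

lemma substitute_append_pivot:
  "supported_below (length Z) v \<Longrightarrow> substitute 0 (Z @ [z]) v = substitute 0 Z v"
  by (auto simp: substitute_def supported_below_def nth_append fun_eq_iff)

text \<open>
  Row reduction, one row at a time. A row that is a combination of the rows \<open>Z\<close> collected so far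
  contributes the vector of its coefficients, and any other row is added to \<open>Z\<close> and contributes a
  pivot. By the choice of \<open>Z\<close> no nontrivial combination of its rows vanishes.
\<close>

lemma echelon_factorisation:
  fixes rs :: "(nat \<Rightarrow> 'a::field) list"
  shows "\<exists>ys Z. length ys = length rs \<and> echelon 0 ys (length Z) \<and> set Z \<subseteq> set rs \<and>
     rs = map (substitute 0 Z) ys \<and>
     (\<forall>v. supported_below (length Z) v \<longrightarrow> substitute 0 Z v = (\<lambda>_. 0) \<longrightarrow> v = (\<lambda>_. 0))"
proof (induction rs rule: rev_induct)
  case Nil
  have "v = (\<lambda>_. 0)" if "supported_below 0 v" for v :: "nat \<Rightarrow> 'a"
    using that by (auto simp: supported_below_def)
  then show ?case by (intro exI[of _ "[]"]) auto
next
  case (snoc r rs)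
  then obtain ys Z where len: "length ys = length rs" and ech: "echelon 0 ys (length Z)"
    and sub: "set Z \<subseteq> set rs" and rs: "rs = map (substitute 0 Z) ys"
    and indep: "\<And>v. supported_below (length Z) v \<Longrightarrow> substitute 0 Z v = (\<lambda>_. 0) \<Longrightarrow> v = (\<lambda>_. 0)"
    by blast
  show ?case
  proof (cases "\<exists>a. supported_below (length Z) a \<and> substitute 0 Z a = r")
    case True
    then obtain a where a: "supported_below (length Z) a" "substitute 0 Z a = r" by blast
    have "echelon 0 (ys @ [a]) (length Z)" using echelon_append[OF ech] a by simp
    then show ?thesis using len sub rs indep a(2)
      by (intro exI[of _ "ys @ [a]"] exI[of _ Z]) auto
  next
    case False
    let ?k = "length Z"
    have "echelon 0 (ys @ [unit_fun ?k]) (Suc ?k)" using echelon_append[OF ech] by simp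
    moreover have "map (substitute 0 (Z @ [r])) ys = rs"
      using echelon_imp_supported[OF ech] by (simp add: rs substitute_append_pivot)
    moreover have "substitute 0 (Z @ [r]) (unit_fun ?k) = r"
      using substitute_pivot[of ?k "Z @ [r]" 0] by simp
    moreover have "v = (\<lambda>_. 0)" if v: "supported_below (Suc ?k) v"
      and zero: "substitute 0 (Z @ [r]) v = (\<lambda>_. 0)" for v
    proof (cases "v ?k = 0")
      case True
      then have "supported_below ?k v"
        using v by (auto simp: supported_below_def Suc_le_eq elim!: le_neq_trans dest: le_neq_implies_less)
      then show ?thesis using indep zero by (simp add: substitute_append_pivot)
    next
      case nz: False
      \<comment> \<open>solving the vanishing combination for \<open>r\<close> would exhibit \<open>r\<close> as a combination of \<open>Z\<close>\<close>
      define w where "w = (\<lambda>j. if j < ?k then - v j / v ?k else 0)"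
      have "substitute 0 Z w j = r j" for j
      proof -
        have "(\<Sum>i<?k. v i * (Z ! i) j) + v ?k * r j = 0"
          using fun_cong[OF zero, of j] by (simp add: substitute_def nth_append)
        then have "r j = - (\<Sum>i<?k. v i * (Z ! i) j) / v ?k"
          using nz by (simp add: field_simps eq_neg_iff_add_eq_0 add.commute)
        also have "\<dots> = substitute 0 Z w j"
          by (simp add: substitute_def w_def sum_divide_distrib flip: sum_negf)
        finally show ?thesis ..
      qed
      moreover have "supported_below ?k w" by (simp add: supported_below_def w_def)
      ultimately show ?thesis using False by auto
    qed
    ultimately show ?thesis using len sub
      by (intro exI[of _ "ys @ [unit_fun ?k]"] exI[of _ "Z @ [r]"]) auto
  qed
qed

lemma column_factorisation:
  fixes A :: "'a::field mat"
  assumes A: "A \<in> carrier_mat n p"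
  obtains k ys C where "ys \<in> echelon_words 0 n k" "C \<in> carrier_mat k p" "A = word_matrix k ys * C"
    "trivial_kernel C\<^sup>T"
proof -
  obtain ys Z where len: "length ys = length (matrix_rows A)" and ech: "echelon 0 ys (length Z)"
    and sub: "set Z \<subseteq> set (matrix_rows A)" and rs: "matrix_rows A = map (substitute 0 Z) ys"
    and indep: "\<And>v. supported_below (length Z) v \<Longrightarrow> substitute 0 Z v = (\<lambda>_. 0) \<Longrightarrow> v = (\<lambda>_. 0)"
    using echelon_factorisation[of "matrix_rows A"] by blast
  have Z: "supported_below p (Z ! i)" if "i < length Z" for i
    using sub A nth_mem[OF that] matrix_rows(2)[of "Z ! i" A] by auto
  show thesis
  proof (rule that)
    show "ys \<in> echelon_words 0 n (length Z)" using len ech A by (simp add: echelon_words_def)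
    show "word_matrix p Z \<in> carrier_mat (length Z) p" by simp
    have "A = word_matrix p (matrix_rows A)" using A by auto
    then show "A = word_matrix (length Z) ys * word_matrix p Z"
      unfolding rs word_matrix_substitute .
    have "v = 0\<^sub>v (length Z)"
      if v: "v \<in> carrier_vec (length Z)" and zero: "(word_matrix p Z)\<^sup>T *\<^sub>v v = 0\<^sub>v p" for v
    proof -
    define f where "f = (\<lambda>j. if j < length Z then v $ j else 0)"
    have "substitute 0 Z f j = 0" for j
    proof (cases "j < p")
      case True
      then have "((word_matrix p Z)\<^sup>T *\<^sub>v v) $ j = (\<Sum>i<length Z. (Z ! i) j * v $ i)"
        using v by (auto simp: word_matrix_def scalar_prod_def atLeast0LessThan)
      then have "(\<Sum>i<length Z. (Z ! i) j * v $ i) = 0" using zero True by simp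
      then show ?thesis by (simp add: substitute_def f_def mult.commute)
    next
      case False
      then show ?thesis using Z by (simp add: substitute_def supported_below_def)
    qed
    then have zero_f: "substitute 0 Z f = (\<lambda>_. 0)" by (rule ext)
    have "supported_below (length Z) f" by (simp add: supported_below_def f_def)
    then have "f = (\<lambda>_. 0)" using zero_f by (rule indep)
    then have "f i = 0" for i by simp
    then have "v $ i = 0" if "i < length Z" for i
      using that by (metis f_def)
    then show "v = 0\<^sub>v (length Z)" using v by auto
    qed
    then show "trivial_kernel (word_matrix p Z)\<^sup>T" by (simp add: trivial_kernel_def)
  qed
qed

text \<open>
  Column reduction of \<open>A = X * C\<close> and then of the transpose of \<open>C\<close>. The middle factor \<open>D\<close> has
  trivial kernel because \<open>C\<close> has independent rows, and its transpose has trivial kernel by construction;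
  hence it is square and invertible.
\<close>

lemma full_factorisation:
  fixes A :: "'a::field mat"
  assumes A: "A \<in> carrier_mat n p"
  obtains k ys zs T where "ys \<in> echelon_words 0 n k" "zs \<in> echelon_words 0 p k" "T \<in> GL k"
    "A = word_matrix k ys * T * (word_matrix k zs)\<^sup>T"
proof -
  obtain k ys C where ys: "ys \<in> echelon_words 0 n k" and C: "C \<in> carrier_mat k p"
    and A_eq: "A = word_matrix k ys * C" and kerC: "trivial_kernel C\<^sup>T"
    by (rule column_factorisation[OF A])
  have CT: "C\<^sup>T \<in> carrier_mat p k" using C by simp
  obtain l zs D where zs: "zs \<in> echelon_words 0 p l" and D: "D \<in> carrier_mat l k"
    and C_eq: "C\<^sup>T = word_matrix l zs * D" and kerD: "trivial_kernel D\<^sup>T"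
    by (rule column_factorisation[OF CT])
  have wz: "word_matrix l zs \<in> carrier_mat p l" using zs by (rule word_matrix_in_carrier)
  have wy: "word_matrix k ys \<in> carrier_mat n k" using ys by (rule word_matrix_in_carrier)
  have "v = 0\<^sub>v k" if "v \<in> carrier_vec k" "D *\<^sub>v v = 0\<^sub>v l" for v
  proof (rule trivial_kernelD[OF kerC CT that(1)])
    have "C\<^sup>T *\<^sub>v v = word_matrix l zs *\<^sub>v (D *\<^sub>v v)"
      unfolding C_eq using wz D that(1) by (rule assoc_mult_mat_vec)
    also have "\<dots> = 0\<^sub>v p" unfolding that(2) using wz by (intro eq_vecI) auto
    finally show "C\<^sup>T *\<^sub>v v = 0\<^sub>v p" .
  qed
  then have ker: "trivial_kernel D" using D by (simp add: trivial_kernel_def)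
  have "l = k" by (rule trivial_kernels_imp_GL(1)[OF D ker kerD])
  have DGL: "D \<in> GL k" by (rule trivial_kernels_imp_GL(2)[OF D ker kerD])
  have Dk: "D \<in> carrier_mat k k" using D \<open>l = k\<close> by simp
  have DT: "D\<^sup>T \<in> GL k" by (rule GL_transpose[OF DGL])
  have "C = D\<^sup>T * (word_matrix k zs)\<^sup>T"
    using arg_cong[OF C_eq, of transpose_mat] transpose_mult[OF wz D] \<open>l = k\<close> by simp
  then have "A = word_matrix k ys * D\<^sup>T * (word_matrix k zs)\<^sup>T"
    unfolding A_eq using wy Dk wz \<open>l = k\<close> by (simp add: assoc_mult_mat[of _ n k _ k _ p])
  with ys zs DT show thesis unfolding \<open>l = k\<close> by (rule that)
qed

lemma rank_word_product:
  fixes T :: "'a::field mat"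
  assumes ys: "ys \<in> echelon_words 0 n k" and zs: "zs \<in> echelon_words 0 p k" and T: "T \<in> GL k"
  shows "word_matrix k ys * T * (word_matrix k zs)\<^sup>T \<in> mats_of_rank n p k"
proof -
  have wz: "word_matrix k zs \<in> carrier_mat p k" using zs by (rule word_matrix_in_carrier)
  have wy: "word_matrix k ys \<in> carrier_mat n k" using ys by (rule word_matrix_in_carrier)
  have Tc: "T \<in> carrier_mat k k" using T by (simp add: GL_def)
  obtain S where S: "S \<in> carrier_mat k k" "S * T = 1\<^sub>m k" using GL_inverse[OF T] .
  obtain L where L: "L \<in> carrier_mat k n" "L * word_matrix k ys = 1\<^sub>m k"
    using word_matrix_left_inverse[of ys k] ys by (auto simp: echelon_words_def)
  obtain M where M: "M \<in> carrier_mat k p" "M * word_matrix k zs = 1\<^sub>m k"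
    using word_matrix_left_inverse[of zs k] zs by (auto simp: echelon_words_def)
  have "vec_space.rank n (word_matrix k ys * T * (word_matrix k zs)\<^sup>T) = k"
  proof (rule rank_full_factorisation)
    show "(S * L) * (word_matrix k ys * T) = 1\<^sub>m k"
    proof -
      have "(S * L) * (word_matrix k ys * T) = S * (L * word_matrix k ys * T)"
        using S L(1) wy Tc by (simp add: assoc_mult_mat[of _ k k _ n _ k] assoc_mult_mat[of _ k n _ k _ k])
      then show ?thesis using L S Tc by simp
    qed
    show "(word_matrix k zs)\<^sup>T * M\<^sup>T = 1\<^sub>m k"
      using transpose_mult[OF M(1) wz] M(2) by simp
  qed (use S L M wy wz Tc in auto)
  then show ?thesis using wy wz Tc by (auto simp: mats_of_rank_def)
qed

text \<open>
  A factorisation of \<open>A\<close> with middle factor of size \<open>k\<close> transposes to one of the same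
  shape. RCEF is defined by the transpose and its rank, whereas \<open>rcef_mats\<close> prescribes the rank of
  the matrix itself; this lemma reconciles the two.
\<close>

lemma rank_transpose:
  fixes A :: "'a::field mat"
  assumes A: "A \<in> carrier_mat n p"
  shows "vec_space.rank p A\<^sup>T = vec_space.rank n A"
proof -
  obtain k ys zs T where ys: "ys \<in> echelon_words 0 n k" and zs: "zs \<in> echelon_words 0 p k"
    and T: "T \<in> GL k" and A_eq: "A = word_matrix k ys * T * (word_matrix k zs)\<^sup>T"
    by (rule full_factorisation[OF A])
  have wz: "word_matrix k zs \<in> carrier_mat p k" using zs by (rule word_matrix_in_carrier)
  have wy: "word_matrix k ys \<in> carrier_mat n k" using ys by (rule word_matrix_in_carrier)
  have Tc: "T \<in> carrier_mat k k" using T by (simp add: GL_def)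
  have "T\<^sup>T \<in> GL k" by (rule GL_transpose[OF T])
  moreover have "A\<^sup>T = word_matrix k zs * T\<^sup>T * (word_matrix k ys)\<^sup>T"
  proof -
    have "A\<^sup>T = word_matrix k zs * (word_matrix k ys * T)\<^sup>T"
      unfolding A_eq using transpose_mult[OF mult_carrier_mat[OF wy Tc], of "(word_matrix k zs)\<^sup>T" p] wz
      by simp
    also have "\<dots> = word_matrix k zs * (T\<^sup>T * (word_matrix k ys)\<^sup>T)"
      by (simp add: transpose_mult[OF wy Tc])
    finally show ?thesis
      using assoc_mult_mat[OF wz, of "T\<^sup>T" k "(word_matrix k ys)\<^sup>T" n] wy Tc by simp
  qed
  ultimately show ?thesis
    using rank_word_product[OF ys zs T] rank_word_product[OF zs ys] A_eq by (auto simp: mats_of_rank_def)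
qed

section \<open>Reduced column echelon form\<close>

text \<open>
  The spans in the definition of RREF, in terms of coordinates. The span is the column space of the
  first \<open>i\<close> columns of the identity matrix.
\<close>

lemma span_unit_vecs:
  fixes v :: "'a::field vec"
  assumes "i \<le> k"
  shows "v \<in> span_vec k {unit_vec k l | l. l < i} \<longleftrightarrow>
    v \<in> carrier_vec k \<and> (\<forall>j<k. i \<le> j \<longrightarrow> v $ j = 0)"
proof -
  interpret vec_space "TYPE('a)" k .
  define E where "E = mat k i (\<lambda>(a, b). if a = b then 1 else 0 :: 'a)"
  have E: "E \<in> carrier_mat k i" by (simp add: E_def)
  have col_E: "col E l = unit_vec k l" if "l < i" for l
    using that assms by (intro eq_vecI) (auto simp: E_def unit_vec_def)
  have "set (cols E) = {unit_vec k l | l. l < i}"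
    using col_E E by (auto simp: cols_def)
  then have span: "span_vec k {unit_vec k l | l. l < i} = col_space E"
    by (simp add: col_space_def)
  have entry: "(E *\<^sub>v x) $ j = (if j < i then x $ j else 0)" if "x \<in> carrier_vec i" "j < k" for x j
    using that by (auto simp: E_def scalar_prod_def if_distrib[of "\<lambda>t. t * _"] cong: if_cong)
  show ?thesis unfolding span
  proof
    assume "v \<in> col_space E"
    then obtain x where "x \<in> carrier_vec i" "E *\<^sub>v x = v" using E by (auto simp: col_space_eq[OF E])
    then show "v \<in> carrier_vec k \<and> (\<forall>j<k. i \<le> j \<longrightarrow> v $ j = 0)"
      using entry E by auto
  next
    assume v: "v \<in> carrier_vec k \<and> (\<forall>j<k. i \<le> j \<longrightarrow> v $ j = 0)"
    have "E *\<^sub>v vec i (\<lambda>j. v $ j) = v"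
    proof (rule eq_vecI)
      fix j assume "j < dim_vec v"
      then have "j < k" using v by auto
      then show "(E *\<^sub>v vec i (\<lambda>j. v $ j)) $ j = v $ j"
        using v assms by (simp add: entry not_less)
    qed (use E v in auto)
    then show "v \<in> col_space E" using E v by (auto simp: col_space_eq[OF E])
  qed
qed

lemma pivots_iff_span:
  fixes xs :: "(nat \<Rightarrow> 'a::field) list"
  assumes "\<forall>v\<in>set xs. supported_below k v"
  shows "pivots 0 xs k p \<longleftrightarrow> strict_mono_on {..<k} p \<and>
    (\<forall>i<k. p i < length xs \<and>
       (word_matrix k xs)\<^sup>T *\<^sub>v unit_vec (length xs) (p i) = unit_vec k i \<and>
       span_vec k {(word_matrix k xs)\<^sup>T *\<^sub>v unit_vec (length xs) l | l. l < p i}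
         = span_vec k {unit_vec k l | l. l < i})" (is "_ \<longleftrightarrow> _ \<and> (\<forall>i<k. ?R i)")
proof -
  interpret vec_space "TYPE('a)" k .
  let ?A = "(word_matrix k xs)\<^sup>T"
  have row: "?A *\<^sub>v unit_vec (length xs) l = vec k (xs ! l)" if "l < length xs" for l
  proof -
    have "?A *\<^sub>v unit_vec (length xs) l = col ?A l"
      using that by (intro mult_unit_vec) auto
    also have "\<dots> = vec k (xs ! l)" using that by (intro eq_vecI) (auto simp: word_matrix_def)
    finally show ?thesis .
  qed
  have row_carrier: "?A *\<^sub>v unit_vec (length xs) l \<in> carrier_vec k" for l
    by (rule mult_mat_vec_carrier[of _ k "length xs"]) simp_all
  have supp: "supported_below k (xs ! l)" if "l < length xs" for l
    using assms nth_mem[OF that] by blast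
  have unit: "vec k (xs ! l) = unit_vec k i \<longleftrightarrow> xs ! l = unit_fun i" if "l < length xs" "i < k" for l i
  proof
    assume eq: "vec k (xs ! l) = unit_vec k i"
    show "xs ! l = unit_fun i"
    proof
      fix j show "(xs ! l) j = unit_fun i j"
        using arg_cong[OF eq, of "\<lambda>v. v $ j"] supp[OF that(1)] that(2)
        by (cases "j < k") (auto simp: unit_fun_def supported_below_def)
    qed
  next
    assume "xs ! l = unit_fun i"
    then show "vec k (xs ! l) = unit_vec k i" by (auto simp: unit_fun_def unit_vec_def intro!: eq_vecI)
  qed
  have below: "vec k (xs ! l) \<in> span_vec k {unit_vec k l | l. l < i} \<longleftrightarrow> supported_below i (xs ! l)"
    if "l < length xs" "i < k" for l i
    using supp[OF that(1)] that(2) by (auto simp: span_unit_vecs supported_below_def) (metis leI)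
  let ?P = "\<lambda>i. p i < length xs \<and> xs ! p i = unit_fun i \<and> (\<forall>l<p i. supported_below i (xs ! l))"
  have R_imp_P: "?P i" if R: "?R i" and i: "i < k" for i
  proof (intro conjI allI impI)
    show p: "p i < length xs" using R by blast
    show "xs ! p i = unit_fun i" using R row[OF p] unit[OF p i] by simp
    fix l assume l: "l < p i"
    let ?S = "{?A *\<^sub>v unit_vec (length xs) l | l. l < p i}"
    have "?S \<subseteq> carrier_vec k" using row_carrier by blast
    moreover have "?A *\<^sub>v unit_vec (length xs) l \<in> ?S" using l by blast
    ultimately have "?A *\<^sub>v unit_vec (length xs) l \<in> span_vec k ?S"
      by (intro subsetD[OF in_own_span])
    then have "?A *\<^sub>v unit_vec (length xs) l \<in> span_vec k {unit_vec k l | l. l < i}"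
      unfolding R[THEN conjunct2, THEN conjunct2] .
    then show "supported_below i (xs ! l)" using row[of l] below[of l i] p l i by simp
  qed
  have P_imp_R: "?R i" if mono: "strict_mono_on {..<k} p" and P: "\<forall>i<k. ?P i" and i: "i < k" for i
  proof (intro conjI)
    show p: "p i < length xs" using P i by blast
    show "?A *\<^sub>v unit_vec (length xs) (p i) = unit_vec k i"
      using P i row[OF p] unit[OF p i] by simp
    let ?S = "{?A *\<^sub>v unit_vec (length xs) l | l. l < p i}" and ?U = "{unit_vec k l :: 'a vec | l. l < i}"
    have S: "?S \<subseteq> carrier_vec k" using row_carrier by blast
    have U: "?U \<subseteq> carrier_vec k" by auto
    have "?S \<subseteq> span_vec k ?U"
    proof
      fix v assume "v \<in> ?S"
      then obtain l where l: "l < p i" "v = ?A *\<^sub>v unit_vec (length xs) l" by blast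
      then have "l < length xs" using p by simp
      then show "v \<in> span_vec k ?U" unfolding l(2) row[OF \<open>l < length xs\<close>] below[OF \<open>l < length xs\<close> i]
        using P i l by blast
    qed
    moreover have "?U \<subseteq> span_vec k ?S"
    proof
      fix v :: "'a vec" assume "v \<in> ?U"
      then obtain l where l: "l < i" "v = unit_vec k l" by blast
      then have lk: "l < k" using i by simp
      have "p l < p i" using mono l lk i by (auto simp: strict_mono_on_def)
      moreover have "?A *\<^sub>v unit_vec (length xs) (p l) = unit_vec k l"
        using P lk row[of "p l"] unit[of "p l" l] by simp
      ultimately have "v \<in> ?S" unfolding l(2) by (intro CollectI exI[of _ "p l"]) simp
      then show "v \<in> span_vec k ?S" using in_own_span[OF S] by blast
    qed
    ultimately show "span_vec k ?S = span_vec k ?U"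
      by (intro subset_antisym span_is_subset span_is_submodule S U)
  qed
  have pivots_iff: "pivots 0 xs k p \<longleftrightarrow> strict_mono_on {..<k} p \<and> (\<forall>i<k. ?P i)"
    using assms by (auto simp: pivots_def lessThan_atLeast0)
  show ?thesis
    unfolding pivots_iff
  proof (rule conj_cong[OF refl], rule iffI)
    assume mono: "strict_mono_on {..<k} p" and P: "\<forall>i<k. ?P i"
    show "\<forall>i<k. ?R i"
    proof (intro allI impI)
      fix i assume "i < k"
      then show "?R i" by (rule P_imp_R[OF mono P])
    qed
  next
    assume R: "\<forall>i<k. ?R i"
    show "\<forall>i<k. ?P i"
    proof (intro allI impI)
      fix i assume i: "i < k"
      show "?P i" by (rule R_imp_P[OF mp[OF spec[OF R] i] i])
    qed
  qed
qed

lemma rcef_word_matrix_iff: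
  fixes xs :: "(nat \<Rightarrow> 'a::field) list"
  assumes "\<forall>v\<in>set xs. supported_below k v" and "vec_space.rank (length xs) (word_matrix k xs) = k"
  shows "rcef (word_matrix k xs) \<longleftrightarrow> echelon 0 xs k"
proof -
  have rank: "vec_space.rank k (word_matrix k xs)\<^sup>T = k"
    using rank_transpose[of "word_matrix k xs" "length xs" k] assms(2) by simp
  have "rcef (word_matrix k xs) \<longleftrightarrow> (\<exists>p. pivots 0 xs k p)"
    unfolding pivots_iff_span[OF assms(1)] rcef_def rref_def Let_def
    by (simp add: rank)
  then show ?thesis using echelon_imp_pivots pivots_imp_echelon by blast
qed

theorem rcef_mats_eq_echelon_words:
  "rcef_mats n k = word_matrix k ` (echelon_words 0 n k :: (nat \<Rightarrow> 'a::field) list set)"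
proof (intro equalityI subsetI)
  fix A :: "'a mat" assume "A \<in> rcef_mats n k"
  then have A: "A \<in> carrier_mat n k" "vec_space.rank n A = k" "rcef A"
    by (auto simp: rcef_mats_def mats_of_rank_def)
  let ?xs = "matrix_rows A"
  have supp: "\<forall>v\<in>set ?xs. supported_below k v" and len: "length ?xs = n" and wm: "word_matrix k ?xs = A"
    using A(1) matrix_rows(2)[of _ A] matrix_rows(3)[of A] by auto
  have "echelon 0 ?xs k" using rcef_word_matrix_iff[OF supp] A by (simp add: len wm)
  then show "A \<in> word_matrix k ` echelon_words 0 n k"
    using wm len by (intro image_eqI[of _ _ ?xs]) (auto simp: echelon_words_def)
next
  fix A :: "'a mat" assume "A \<in> word_matrix k ` echelon_words 0 n k"
  then obtain xs where A: "A = word_matrix k xs" and xs: "xs \<in> echelon_words 0 n k" by blast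
  then have ech: "echelon 0 xs k" and len: "length xs = n" by (auto simp: echelon_words_def)
  obtain L where L: "L \<in> carrier_mat k n" "L * word_matrix k xs = 1\<^sub>m k"
    using word_matrix_left_inverse[OF ech] len by blast
  have "vec_space.rank n (word_matrix k xs * 1\<^sub>m k) = k"
    by (rule rank_full_factorisation[OF word_matrix_in_carrier[OF xs] _ L, of _ _ "1\<^sub>m k"]) auto
  then have rank: "vec_space.rank n (word_matrix k xs) = k"
    using word_matrix_in_carrier[OF xs] by (metis right_mult_one_mat)
  moreover have "rcef (word_matrix k xs)"
    using rcef_word_matrix_iff[of xs k] echelon_imp_supported[OF ech] ech rank len by simp
  ultimately show "A \<in> rcef_mats n k"
    using word_matrix_in_carrier[OF xs] by (simp add: A rcef_mats_def mats_of_rank_def)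
qed

section \<open>Uniqueness\<close>

text \<open>
  Uniqueness of the reduced echelon form. Assume that the substitution fixes the first \<open>d\<close> unit vectors. A row of
  \<open>ys\<close> before the next pivot is a combination of these, so it is fixed. At the next pivot of \<open>ys\<close> the
  image cannot be a combination of the first \<open>d\<close> unit vectors, since such vectors are their own images
  and the substitution is injective; so the image is the pivot itself.
\<close>

lemma echelon_substitution_rigid:
  assumes "echelon d ys k" "echelon d (map (substitute 0 Z) ys) k" "length Z = k"
    and "\<forall>i<d. Z ! i = unit_fun i" "inj_on (substitute 0 Z) {v. supported_below k v}"
  shows "\<forall>i<k. Z ! i = unit_fun i"
  using assms
proof (induction ys arbitrary: d)
  case (Cons v ys)
  have fixed: "substitute 0 Z w = w" if w: "supported_below d w" for w
  proof
    fix j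
    have dk: "d \<le> length Z" using echelon_le[OF Cons.prems(1)] Cons.prems(3) by simp
    have "(\<Sum>i<length Z. w i * (Z ! i) j) = (\<Sum>i<length Z. if i = j then w j else 0)"
    proof (rule sum.cong)
      fix i
      show "w i * (Z ! i) j = (if i = j then w j else 0)"
        using w Cons.prems(4) by (cases "i < d") (auto simp: supported_below_def unit_fun_def)
    qed simp
    also have "\<dots> = w j" using w dk by (auto simp: supported_below_def)
    finally show "substitute 0 Z w j = w j" by (simp add: substitute_def)
  qed
  consider "supported_below d v" "echelon d ys k" | "v = unit_fun d" "echelon (Suc d) ys k"
    using Cons.prems(1) by auto
  then show ?case
  proof cases
    case 1
    then have "echelon d (map (substitute 0 Z) ys) k"
      using Cons.prems(2) fixed[OF 1(1)] by auto
    then show ?thesis using Cons.IH[OF 1(2)] Cons.prems by blast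
  next
    case 2
    have dk: "d < k" using echelon_le[OF 2(2)] by simp
    have Zd: "substitute 0 Z v = Z ! d" using substitute_pivot[of d Z 0] 2(1) dk Cons.prems(3) by simp
    have "Z ! d = unit_fun d"
    proof (rule ccontr)
      assume ne: "Z ! d \<noteq> unit_fun d"
      then have letter: "supported_below d (Z ! d)" using Cons.prems(2) Zd by auto
      then have "substitute 0 Z (Z ! d) = substitute 0 Z v" using fixed Zd by simp
      moreover have "supported_below k (Z ! d)" "supported_below k v"
        using letter supported_below_mono dk 2(1) supported_below_unit_fun by (blast dest: less_imp_le)+
      ultimately have "Z ! d = v" using Cons.prems(5) by (auto dest: inj_onD)
      then show False using ne 2(1) by simp
    qed
    then have "echelon (Suc d) (map (substitute 0 Z) ys) k" "\<forall>i<Suc d. Z ! i = unit_fun i"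
      using Cons.prems(2,4) Zd by (auto simp: less_Suc_eq)
    then show ?thesis using Cons.IH[OF 2(2)] Cons.prems by blast
  qed
qed simp

lemma supported_below_substitute:
  assumes "\<forall>z\<in>set Z. supported_below k z"
  shows "supported_below k (substitute 0 Z v)"
  unfolding supported_below_def
proof (intro allI impI)
  fix j assume "k \<le> j"
  then have "v i * (Z ! i) j = 0" if "i < length Z" for i
    using assms nth_mem[OF that] by (auto simp: supported_below_def)
  then have "(\<Sum>i<length Z. v i * (Z ! i) j) = 0" by (intro sum.neutral) blast
  then show "substitute 0 Z v j = 0" by (simp add: substitute_def)
qed

lemma echelon_words_rigid:
  fixes S :: "'a::field mat"
  assumes xs: "xs \<in> echelon_words 0 n k" and ys: "ys \<in> echelon_words 0 n k"
    and S: "S \<in> carrier_mat k k" "S' \<in> carrier_mat k k" "S * S' = 1\<^sub>m k"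
    and eq: "word_matrix k xs = word_matrix k ys * S"
  shows "S = 1\<^sub>m k"
proof -
  define Z where "Z = matrix_rows S"
  have Z: "length Z = k" "word_matrix k Z = S" "\<forall>v\<in>set Z. supported_below k v"
    using S(1) matrix_rows(2)[of _ S] matrix_rows(3)[of S] by (auto simp: Z_def)
  have ech: "echelon 0 xs k" "echelon 0 ys k" using xs ys by (auto simp: echelon_words_def)
  have supp: "supported_below k (substitute 0 Z v)" for v
    using Z(3) by (rule supported_below_substitute)
  have xs_eq: "xs = map (substitute 0 Z) ys"
  proof (rule word_matrix_inj)
    show "word_matrix k xs = word_matrix k (map (substitute 0 Z) ys)"
      unfolding word_matrix_substitute Z using eq .
  qed (use supp echelon_imp_supported[OF ech(1)] in auto)
  define W where "W = matrix_rows S'"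
  have W: "length W = k" "word_matrix k W = S'"
    using S(2) matrix_rows(3)[of S'] by (auto simp: W_def)
  have inv: "map (substitute 0 W) Z = map unit_fun [0..<k]"
  proof (rule word_matrix_inj[of k])
    show "word_matrix k (map (substitute 0 W) Z) = word_matrix k (map unit_fun [0..<k])"
      unfolding word_matrix_substitute W Z S(3)
      by (rule eq_matI) (auto simp: word_matrix_def unit_fun_def)
    have "\<forall>v\<in>set W. supported_below k v" using S(2) matrix_rows(2)[of _ S'] by (auto simp: W_def)
    then show "\<forall>v\<in>set (map (substitute 0 W) Z). supported_below k v"
      by (simp add: supported_below_substitute)
  qed (auto intro: supported_below_unit_fun)
  have id: "substitute 0 W (substitute 0 Z v) = v" if "supported_below k v" for v
  proof -
    have "substitute 0 W (substitute 0 Z v) = substitute 0 (map unit_fun [0..<k] @ []) v"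
      by (simp add: substitute_substitute inv)
    also have "\<dots> = substitute k [] v" by (simp only: substitute_eq_full[symmetric])
    finally show ?thesis using that by simp
  qed
  have "inj_on (substitute 0 Z) {v. supported_below k v}"
    by (rule inj_on_inverseI[of _ "substitute 0 W"]) (simp add: id)
  then have "\<forall>i<k. Z ! i = unit_fun i"
    using echelon_substitution_rigid[OF ech(2) _ Z(1)] ech(1) xs_eq by simp
  then have "word_matrix k Z = 1\<^sub>m k"
    using Z(1) by (intro eq_matI) (auto simp: word_matrix_def unit_fun_def)
  then show ?thesis using Z by simp
qed

text \<open>
  Cancelling the right factors shows that each of the two left factors is the other times a square
  matrix, and these two square matrices are mutually inverse because RCEF matrices of full rank can be
  cancelled on the left. Then \<open>echelon_words_rigid\<close> applies.
\<close>

lemma left_factor_unique: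
  fixes T T' :: "'a::field mat"
  assumes xs: "xs \<in> echelon_words 0 n k" and xs': "xs' \<in> echelon_words 0 n k"
    and zs: "zs \<in> echelon_words 0 p k" and zs': "zs' \<in> echelon_words 0 p k"
    and T: "T \<in> GL k" and T': "T' \<in> GL k"
    and eq: "word_matrix k xs * T * (word_matrix k zs)\<^sup>T = word_matrix k xs' * T' * (word_matrix k zs')\<^sup>T"
  shows "word_matrix k xs = word_matrix k xs'"
proof -
  have half: "\<exists>S\<in>carrier_mat k k. X = X' * S"
    if X: "X \<in> carrier_mat n k" "X' \<in> carrier_mat n k"
      and W: "ws \<in> echelon_words 0 p k" "ws' \<in> echelon_words 0 p k"
      and U: "U \<in> GL k" "U' \<in> GL k"
      and eq: "X * U * (word_matrix k ws)\<^sup>T = X' * U' * (word_matrix k ws')\<^sup>T"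
    for X X' U U' :: "'a mat" and ws ws'
  proof -
    let ?W = "word_matrix k ws" and ?W' = "word_matrix k ws'"
    have Wc: "?W \<in> carrier_mat p k" "?W' \<in> carrier_mat p k" using W word_matrix_in_carrier by blast+
    obtain M where M: "M \<in> carrier_mat k p" "M * ?W = 1\<^sub>m k"
      using word_matrix_left_inverse[of ws k] W(1) by (auto simp: echelon_words_def)
    have WM: "?W\<^sup>T * M\<^sup>T = 1\<^sub>m k" using transpose_mult[OF M(1) Wc(1)] M(2) by simp
    obtain V where V: "V \<in> carrier_mat k k" "U * V = 1\<^sub>m k" using GL_inverse[OF U(1)] .
    have Uc: "U \<in> carrier_mat k k" "U' \<in> carrier_mat k k" using U by (auto simp: GL_def)
    have c1: "M\<^sup>T \<in> carrier_mat p k" "?W\<^sup>T \<in> carrier_mat k p" "?W'\<^sup>T \<in> carrier_mat k p"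
      using M(1) Wc by auto
    have "X * U = X * U * (?W\<^sup>T * M\<^sup>T)" unfolding WM using X Uc by simp
    also have "\<dots> = X * U * ?W\<^sup>T * M\<^sup>T"
      using assoc_mult_mat[OF mult_carrier_mat[OF X(1) Uc(1)] c1(2,1)] by simp
    also have "\<dots> = X' * U' * ?W'\<^sup>T * M\<^sup>T" unfolding eq ..
    also have "\<dots> = X' * (U' * ?W'\<^sup>T * M\<^sup>T)"
      using assoc_mult_mat[OF X(2) Uc(2) c1(3)]
        assoc_mult_mat[OF X(2) mult_carrier_mat[OF Uc(2) c1(3)] c1(1)] by simp
    finally have XU: "X * U = X' * (U' * ?W'\<^sup>T * M\<^sup>T)" .
    let ?Q = "U' * ?W'\<^sup>T * M\<^sup>T"
    have Q: "?Q \<in> carrier_mat k k" using Uc c1 by auto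
    have "X = X * (U * V)" using X V(2) by simp
    also have "\<dots> = X * U * V" using assoc_mult_mat[OF X(1) Uc(1) V(1)] by simp
    also have "\<dots> = X' * (?Q * V)" unfolding XU using assoc_mult_mat[OF X(2) Q V(1)] .
    finally show ?thesis using Q V(1) by (intro bexI[of _ "?Q * V"]) auto
  qed
  let ?X = "word_matrix k xs" and ?X' = "word_matrix k xs'"
  have X: "?X \<in> carrier_mat n k" "?X' \<in> carrier_mat n k"
    using xs xs' word_matrix_in_carrier by blast+
  obtain S where S: "S \<in> carrier_mat k k" "?X = ?X' * S"
    using half[OF X zs zs' T T' eq] ..
  obtain S' where S': "S' \<in> carrier_mat k k" "?X' = ?X * S'"
    using half[OF X(2,1) zs' zs T' T eq[symmetric]] ..
  obtain L where L: "L \<in> carrier_mat k n" "L * ?X' = 1\<^sub>m k"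
    using word_matrix_left_inverse[of xs' k] xs' by (auto simp: echelon_words_def)
  have "?X' = ?X' * (S * S')"
    using S S' assoc_mult_mat[OF X(2) S(1) S'(1)] by simp
  then have "L * ?X' = L * (?X' * (S * S'))" by simp
  also have "\<dots> = L * ?X' * (S * S')"
    using assoc_mult_mat[OF L(1) X(2) mult_carrier_mat[OF S(1) S'(1)]] by simp
  finally have "S * S' = 1\<^sub>m k" using L(2) S(1) S'(1) by simp
  then have "S = 1\<^sub>m k" using echelon_words_rigid[OF xs xs' S(1) S'(1)] S(2) by simp
  then show ?thesis using S(2) X(2) by simp
qed

text \<open>
  The outer factors are unique by \<open>left_factor_unique\<close>, applied to the equation and to its transpose.
  Both have one-sided inverses, so the middle factor is unique as well.
\<close>

lemma tau2_word_product:
  fixes T :: "'a::field mat"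
  assumes ys: "ys \<in> echelon_words 0 n k" and zs: "zs \<in> echelon_words 0 n k" and T: "T \<in> GL k"
  shows "tau2 n k (word_matrix k ys * T * (word_matrix k zs)\<^sup>T) = T"
  unfolding tau2_def rcef_mats_eq_echelon_words
proof (rule the_equality)
  let ?Y = "word_matrix k ys" and ?Z = "word_matrix k zs"
  show "T \<in> GL k \<and> (\<exists>A0\<in>word_matrix k ` echelon_words 0 n k. \<exists>A1\<in>word_matrix k ` echelon_words 0 n k.
      ?Y * T * ?Z\<^sup>T = A0 * T * A1\<^sup>T)" using assms by blast
  fix T' assume "T' \<in> GL k \<and> (\<exists>A0\<in>word_matrix k ` echelon_words 0 n k.
      \<exists>A1\<in>word_matrix k ` echelon_words 0 n k. ?Y * T * ?Z\<^sup>T = A0 * T' * A1\<^sup>T)"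
  then obtain ys' zs' where T': "T' \<in> GL k"
    and ys': "ys' \<in> echelon_words 0 n k" and zs': "zs' \<in> echelon_words 0 n k"
    and eq: "?Y * T * ?Z\<^sup>T = word_matrix k ys' * T' * (word_matrix k zs')\<^sup>T" by blast
  have Y: "?Y = word_matrix k ys'" by (rule left_factor_unique[OF ys ys' zs zs' T T' eq])
  have c: "?Y \<in> carrier_mat n k" "?Z \<in> carrier_mat n k" "word_matrix k ys' \<in> carrier_mat n k"
    "word_matrix k zs' \<in> carrier_mat n k" "T \<in> carrier_mat k k" "T' \<in> carrier_mat k k"
    using assms ys' zs' T' word_matrix_in_carrier by (auto simp: GL_def)
  have transpose: "(A * U * B\<^sup>T)\<^sup>T = B * U\<^sup>T * A\<^sup>T"
    if "A \<in> carrier_mat n k" "B \<in> carrier_mat n k" "U \<in> carrier_mat k k" for A B U :: "'a mat"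
    using that assoc_mult_mat[of B n k "U\<^sup>T" k "A\<^sup>T" n]
      transpose_mult[OF that(1,3)] transpose_mult[OF mult_carrier_mat[OF that(1,3)], of "B\<^sup>T" n] by simp
  have "?Z * T\<^sup>T * ?Y\<^sup>T = word_matrix k zs' * T'\<^sup>T * (word_matrix k ys')\<^sup>T"
    unfolding transpose[OF c(1,2,5), symmetric] transpose[OF c(3,4,6), symmetric] eq ..
  then have Z: "?Z = word_matrix k zs'"
    by (rule left_factor_unique[OF zs zs' ys ys' GL_transpose[OF T] GL_transpose[OF T']])
  obtain L where L: "L \<in> carrier_mat k n" "L * ?Y = 1\<^sub>m k"
    using word_matrix_left_inverse[of ys k] ys by (auto simp: echelon_words_def)
  obtain M where M: "M \<in> carrier_mat k n" "M * ?Z = 1\<^sub>m k"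
    using word_matrix_left_inverse[of zs k] zs by (auto simp: echelon_words_def)
  have ZM: "?Z\<^sup>T * M\<^sup>T = 1\<^sub>m k" using transpose_mult[OF M(1) c(2)] M(2) by simp
  have core: "L * (?Y * U * ?Z\<^sup>T) * M\<^sup>T = U" if U: "U \<in> carrier_mat k k" for U
  proof -
    have c': "?Z\<^sup>T \<in> carrier_mat k n" "M\<^sup>T \<in> carrier_mat n k" using c M by auto
    have "L * (?Y * U * ?Z\<^sup>T) = L * ?Y * (U * ?Z\<^sup>T)"
      using assoc_mult_mat[OF c(1) U c'(1)] assoc_mult_mat[OF L(1) c(1) mult_carrier_mat[OF U c'(1)]]
      by simp
    also have "\<dots> = U * ?Z\<^sup>T" unfolding L(2) using U c'(1) by simp
    finally have "L * (?Y * U * ?Z\<^sup>T) * M\<^sup>T = U * (?Z\<^sup>T * M\<^sup>T)"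
      using assoc_mult_mat[OF U c'] by simp
    then show ?thesis unfolding ZM using U by simp
  qed
  have same: "?Y * T * ?Z\<^sup>T = ?Y * T' * ?Z\<^sup>T" using eq unfolding Y[symmetric] Z[symmetric] .
  show "T' = T" using core[OF c(5)] unfolding same core[OF c(6)] .
qed

section \<open>The product Ramsey theorem\<close>

text \<open>
  Zero rows in front of an echelon word leave it an echelon word.
\<close>

lemma space_Ramsey_mono:
  assumes "space_Ramsey TYPE('a::field) d k m r n" "n \<le> n'"
  shows "space_Ramsey TYPE('a) d k m r n'"
  unfolding space_Ramsey_def
proof (intro allI impI)
  fix c :: "(nat \<Rightarrow> 'a) list \<Rightarrow> nat" assume c: "\<forall>u. c u < r"
  let ?pad = "\<lambda>u. replicate (n' - n) (\<lambda>_. 0) @ u"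
  have "\<forall>u. c (?pad u) < r" using c by simp
  with assms(1) obtain R where R: "R \<in> echelon_words d n m"
    and mono: "\<forall>Y\<in>echelon_words d m k. \<forall>Z\<in>echelon_words d m k.
      c (?pad (map (substitute d Y) R)) = c (?pad (map (substitute d Z) R))"
    unfolding space_Ramsey_def by (elim allE[of _ "\<lambda>u. c (?pad u)"]) auto
  have pad: "map (substitute d Y) (?pad R) = ?pad (map (substitute d Y) R)"
    for Y :: "(nat \<Rightarrow> 'a) list"
    by simp
  show "\<exists>R\<in>echelon_words d n' m. \<forall>Y\<in>echelon_words d m k. \<forall>Z\<in>echelon_words d m k.
      c (map (substitute d Y) R) = c (map (substitute d Z) R)"
  proof (intro bexI ballI)
    show "?pad R \<in> echelon_words d n' m"
      using R assms(2) echelon_append[of d "replicate (n' - n) (\<lambda>_. 0)" d R]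
      by (auto simp: echelon_words_def echelon_letters_iff)
    fix Y Z :: "(nat \<Rightarrow> 'a) list"
    assume "Y \<in> echelon_words d m k" "Z \<in> echelon_words d m k"
    then show "c (map (substitute d Y) (?pad R)) = c (map (substitute d Z) (?pad R))"
      unfolding pad by (rule mono[rule_format])
  qed
qed

lemma finite_echelon_words: "finite (echelon_words d n k :: (nat \<Rightarrow> 'a::{finite,field}) list set)"
proof (rule finite_subset)
  show "echelon_words d n k \<subseteq> {xs. set xs \<subseteq> {v :: nat \<Rightarrow> 'a. supported_below (d + k) v} \<and> length xs = n}"
    using echelon_imp_supported by (auto simp: echelon_words_def)
qed (intro finite_lists_length_eq finite_supported_below)

text \<open>
  The usual product argument. For the second coordinate one uses the colouring by functions of the first
  coordinate, which ranges over the finite set of words of length \<open>n0\<close> fixed in advance; afterwards the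
  colour no longer depends on the second coordinate. Both coordinates must have the same length \<open>n\<close>,
  which is the reason for padding.
\<close>

lemma product_space_Ramsey:
  fixes k m r :: nat
  obtains n where "\<forall>c :: (nat \<Rightarrow> 'a::{finite,field}) list \<Rightarrow> (nat \<Rightarrow> 'a) list \<Rightarrow> nat. (\<forall>u v. c u v < r) \<longrightarrow>
    (\<exists>R0\<in>echelon_words 0 n m. \<exists>R1\<in>echelon_words 0 n m.
       \<forall>Y\<in>echelon_words 0 m k. \<forall>Y'\<in>echelon_words 0 m k.
       \<forall>Z\<in>echelon_words 0 m k. \<forall>Z'\<in>echelon_words 0 m k.
         c (map (substitute 0 Y) R0) (map (substitute 0 Z) R1)
           = c (map (substitute 0 Y') R0) (map (substitute 0 Z') R1))"
proof -
  obtain n0 where n0: "space_Ramsey TYPE('a) 0 k m r n0" using Graham_Leeb_Rothschild by blast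
  let ?P = "echelon_words 0 n0 k :: (nat \<Rightarrow> 'a) list set"
  from product_colouring[OF finite_echelon_words, of r 0 n0 k]
  obtain s and \<phi> :: "((nat \<Rightarrow> 'a) list \<Rightarrow> nat) \<Rightarrow> nat"
    where \<phi>s [rule_format]: "\<forall>f. (\<forall>p. f p < r) \<longrightarrow> \<phi> f < s"
      and \<phi> [rule_format]: "\<forall>f g. (\<forall>p. f p < r) \<longrightarrow> (\<forall>p. g p < r) \<longrightarrow> \<phi> f = \<phi> g \<longrightarrow>
                  (\<forall>p\<in>?P. f p = g p)" .
  obtain n1 where n1: "space_Ramsey TYPE('a) 0 k m s n1" using Graham_Leeb_Rothschild by blast
  define n where "n = max n0 n1"
  have n: "space_Ramsey TYPE('a) 0 k m s n" using space_Ramsey_mono[OF n1] by (simp add: n_def)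
  show thesis
  proof (rule that, intro allI impI)
    fix c :: "(nat \<Rightarrow> 'a) list \<Rightarrow> (nat \<Rightarrow> 'a) list \<Rightarrow> nat" assume c: "\<forall>u v. c u v < r"
    define pad where "pad u = replicate (n - n0) (\<lambda>_. 0) @ u" for u :: "(nat \<Rightarrow> 'a) list"
    have pad_subst: "map (substitute 0 Y) (pad R) = pad (map (substitute 0 Y) R)" for Y R
      by (simp add: pad_def)
    have pad: "pad R \<in> echelon_words 0 n j" if "R \<in> echelon_words 0 n0 j" for R j
      using that echelon_append[of 0 "replicate (n - n0) (\<lambda>_. 0)" 0 R]
      by (auto simp: echelon_words_def echelon_letters_iff pad_def n_def)
    have "\<forall>v. \<phi> (\<lambda>u. c (pad u) v) < s" using \<phi>s c by simp
    with n obtain R1 where R1: "R1 \<in> echelon_words 0 n m"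
      and R1_mono: "\<forall>Z\<in>echelon_words 0 m k. \<forall>Z'\<in>echelon_words 0 m k.
        \<phi> (\<lambda>u. c (pad u) (map (substitute 0 Z) R1)) = \<phi> (\<lambda>u. c (pad u) (map (substitute 0 Z') R1))"
      unfolding space_Ramsey_def by (elim allE[of _ "\<lambda>v. \<phi> (\<lambda>u. c (pad u) v)"]) auto
    have second: "c (pad u) (map (substitute 0 Z) R1) = c (pad u) (map (substitute 0 Z') R1)"
      if "u \<in> ?P" "Z \<in> echelon_words 0 m k" "Z' \<in> echelon_words 0 m k" for u Z Z'
      by (rule \<phi>[OF _ _ R1_mono[rule_format, OF that(2,3)] that(1)]) (use c in auto)
    \<comment> \<open>an arbitrary value if there are no such words; then there is nothing to show below\<close>
    define Z0 where "Z0 = (SOME Z :: (nat \<Rightarrow> 'a) list. Z \<in> echelon_words 0 m k)"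
    have "\<forall>u. c (pad u) (map (substitute 0 Z0) R1) < r" using c by simp
    with n0 obtain R0 where R0: "R0 \<in> echelon_words 0 n0 m"
      and R0_mono: "\<forall>Y\<in>echelon_words 0 m k. \<forall>Y'\<in>echelon_words 0 m k.
        c (pad (map (substitute 0 Y) R0)) (map (substitute 0 Z0) R1)
          = c (pad (map (substitute 0 Y') R0)) (map (substitute 0 Z0) R1)"
      unfolding space_Ramsey_def
      by (elim allE[of _ "\<lambda>u. c (pad u) (map (substitute 0 Z0) R1)"]) auto
    show "\<exists>R0\<in>echelon_words 0 n m. \<exists>R1\<in>echelon_words 0 n m.
       \<forall>Y\<in>echelon_words 0 m k. \<forall>Y'\<in>echelon_words 0 m k.
       \<forall>Z\<in>echelon_words 0 m k. \<forall>Z'\<in>echelon_words 0 m k.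
         c (map (substitute 0 Y) R0) (map (substitute 0 Z) R1)
           = c (map (substitute 0 Y') R0) (map (substitute 0 Z') R1)"
    proof (rule bexI[OF _ pad[OF R0]], rule bexI[OF _ R1], intro ballI)
      fix Y Y' Z Z' :: "(nat \<Rightarrow> 'a) list"
      assume Y: "Y \<in> echelon_words 0 m k" "Y' \<in> echelon_words 0 m k"
        and Z: "Z \<in> echelon_words 0 m k" "Z' \<in> echelon_words 0 m k"
      have Z0: "Z0 \<in> echelon_words 0 m k" unfolding Z0_def using Z(1) by (rule someI)
      have "c (pad (map (substitute 0 Y) R0)) (map (substitute 0 Z) R1)
          = c (pad (map (substitute 0 Y) R0)) (map (substitute 0 Z0) R1)"
        by (rule second[OF substitute_in_echelon_words[OF R0 Y(1)] Z(1) Z0])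
      also have "\<dots> = c (pad (map (substitute 0 Y') R0)) (map (substitute 0 Z0) R1)"
        by (rule R0_mono[rule_format, OF Y])
      also have "\<dots> = c (pad (map (substitute 0 Y') R0)) (map (substitute 0 Z') R1)"
        by (rule second[OF substitute_in_echelon_words[OF R0 Y(2)] Z0 Z(2)])
      finally show "c (map (substitute 0 Y) (pad R0)) (map (substitute 0 Z) R1)
          = c (map (substitute 0 Y') (pad R0)) (map (substitute 0 Z') R1)"
        unfolding pad_subst .
    qed
  qed
qed

lemma finite_GL: "finite (GL k :: 'a::{finite,field} mat set)"
proof (rule finite_subset)
  show "GL k \<subseteq> word_matrix k ` {xs. set xs \<subseteq> {v :: nat \<Rightarrow> 'a. supported_below k v} \<and> length xs = k}"
  proof
    fix T :: "'a mat" assume "T \<in> GL k"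
    then have T: "dim_row T = k" "dim_col T = k" by (auto simp: GL_def)
    then show "T \<in> word_matrix k ` {xs. set xs \<subseteq> {v. supported_below k v} \<and> length xs = k}"
      using matrix_rows(2)[of _ T] matrix_rows(3)[of T] by (intro image_eqI[of _ _ "matrix_rows T"]) auto
  qed
qed (intro finite_imageI finite_lists_length_eq finite_supported_below)

text \<open>
  If \<open>r = 0\<close>, the choice \<open>n = k\<close> makes the set of matrices nonempty, so that no colouring exists. Otherwise
  the colour of a pair of words is the function that maps \<open>T\<close> to the colour of the matrix with outer
  factors given by the pair and middle factor \<open>T\<close>. Its common value on all pairs is \<open>c'\<close>. If
  \<open>m < k\<close>, there are no pairs and \<open>c'\<close> is evaluated at an arbitrary word, which is harmless as no
  matrix \<open>B\<close> exists.
\<close>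

theorem theorem1p12:
  fixes k m r :: nat
  shows "\<exists>n :: nat. \<forall>c :: ('a::{finite,field}) mat \<Rightarrow> nat.
     c \<in> mats_of_rank n n k \<rightarrow> {..<r} \<longrightarrow>
     (\<exists>R0 \<in> rcef_mats n m. \<exists>R1 \<in> rcef_mats n m.
        \<exists>c' :: 'a mat \<Rightarrow> nat. c' \<in> GL k \<rightarrow> {..<r} \<and>
          (\<forall>B \<in> {R0 * A * transpose_mat R1 | A. A \<in> mats_of_rank m m k}.
             c B = c' (tau2 n k B)))"
proof (cases "r = 0")
  case True
  let ?I = "1\<^sub>m k :: 'a mat"
  have "vec_space.rank k (?I * ?I) = k"
    by (rule rank_full_factorisation[of _ _ _ _ _ ?I ?I]) auto
  then have "?I \<in> mats_of_rank k k k" by (simp add: mats_of_rank_def)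
  then have "c \<notin> mats_of_rank k k k \<rightarrow> {..<r}" for c :: "'a mat \<Rightarrow> nat"
    using True by auto
  then show ?thesis by blast
next
  case False
  from product_colouring[OF finite_GL, of r k]
  obtain s and \<phi> :: "('a mat \<Rightarrow> nat) \<Rightarrow> nat"
    where \<phi>s [rule_format]: "\<forall>f. (\<forall>p. f p < r) \<longrightarrow> \<phi> f < s"
      and \<phi> [rule_format]: "\<forall>f g. (\<forall>p. f p < r) \<longrightarrow> (\<forall>p. g p < r) \<longrightarrow> \<phi> f = \<phi> g \<longrightarrow>
                  (\<forall>p\<in>GL k. f p = g p)" .
  obtain n where n: "\<forall>c :: (nat \<Rightarrow> 'a) list \<Rightarrow> (nat \<Rightarrow> 'a) list \<Rightarrow> nat. (\<forall>u v. c u v < s) \<longrightarrow>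
    (\<exists>R0\<in>echelon_words 0 n m. \<exists>R1\<in>echelon_words 0 n m.
       \<forall>Y\<in>echelon_words 0 m k. \<forall>Y'\<in>echelon_words 0 m k.
       \<forall>Z\<in>echelon_words 0 m k. \<forall>Z'\<in>echelon_words 0 m k.
         c (map (substitute 0 Y) R0) (map (substitute 0 Z) R1)
           = c (map (substitute 0 Y') R0) (map (substitute 0 Z') R1))"
    by (rule product_space_Ramsey)
  show ?thesis
  proof (intro exI[of _ n] allI impI)
    fix c :: "'a mat \<Rightarrow> nat" assume c: "c \<in> mats_of_rank n n k \<rightarrow> {..<r}"
    \<comment> \<open>colour 0 for other matrices, to obtain a total colouring with values below \<open>r\<close>\<close>
    define C where "C u v T =
      (let B = word_matrix k u * T * (word_matrix k v)\<^sup>T in if B \<in> mats_of_rank n n k then c B else 0)"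
      for u v T
    have C: "C u v T < r" for u v T using c False by (auto simp: C_def Let_def)
    then have "\<forall>u v. \<phi> (C u v) < s" by (simp add: \<phi>s)
    then obtain R0 R1 where R: "R0 \<in> echelon_words 0 n m" "R1 \<in> echelon_words 0 n m"
      and mono: "\<forall>Y\<in>echelon_words 0 m k. \<forall>Y'\<in>echelon_words 0 m k.
       \<forall>Z\<in>echelon_words 0 m k. \<forall>Z'\<in>echelon_words 0 m k.
         \<phi> (C (map (substitute 0 Y) R0) (map (substitute 0 Z) R1))
           = \<phi> (C (map (substitute 0 Y') R0) (map (substitute 0 Z') R1))"
      using n[THEN spec, of "\<lambda>u v. \<phi> (C u v)"] by auto
    define y0 where "y0 = (SOME y :: (nat \<Rightarrow> 'a) list. y \<in> echelon_words 0 m k)"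
    define c' where "c' = C (map (substitute 0 y0) R0) (map (substitute 0 y0) R1)"
    let ?R0 = "word_matrix m R0" and ?R1 = "word_matrix m R1"
    have "c (?R0 * A * ?R1\<^sup>T) = c' (tau2 n k (?R0 * A * ?R1\<^sup>T))" if A: "A \<in> mats_of_rank m m k" for A
    proof -
      have Ac: "A \<in> carrier_mat m m" using A by (simp add: mats_of_rank_def)
      obtain k' y z T where yz': "y \<in> echelon_words 0 m k'" "z \<in> echelon_words 0 m k'" "T \<in> GL k'"
        and A_eq: "A = word_matrix k' y * T * (word_matrix k' z)\<^sup>T"
        by (rule full_factorisation[OF Ac])
      have "k' = k" using rank_word_product[OF yz'] A unfolding A_eq by (simp add: mats_of_rank_def)
      note y = yz'(1)[unfolded \<open>k' = k\<close>] and z = yz'(2)[unfolded \<open>k' = k\<close>]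
        and T = yz'(3)[unfolded \<open>k' = k\<close>]
      let ?u = "map (substitute 0 y) R0" and ?v = "map (substitute 0 z) R1"
      have u: "?u \<in> echelon_words 0 n k" by (rule substitute_in_echelon_words[OF R(1) y])
      have v: "?v \<in> echelon_words 0 n k" by (rule substitute_in_echelon_words[OF R(2) z])
      have len: "length y = m" "length z = m" using y z by (auto simp: echelon_words_def)
      have car: "?R0 \<in> carrier_mat n m" "?R1 \<in> carrier_mat n m" "word_matrix k y \<in> carrier_mat m k"
        "word_matrix k z \<in> carrier_mat m k" "T \<in> carrier_mat k k"
        using R y z T word_matrix_in_carrier by (auto simp: GL_def)
      have B: "?R0 * A * ?R1\<^sup>T = word_matrix k ?u * T * (word_matrix k ?v)\<^sup>T"
      proof -
        let ?y = "word_matrix k y" and ?z = "word_matrix k z"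
        have cT: "?z\<^sup>T \<in> carrier_mat k m" "?R1\<^sup>T \<in> carrier_mat m n" using car by auto
        have "?R0 * A = ?R0 * ?y * T * ?z\<^sup>T"
          unfolding A_eq \<open>k' = k\<close>
          using assoc_mult_mat[OF car(1) car(3) car(5)]
            assoc_mult_mat[OF car(1) mult_carrier_mat[OF car(3,5)] cT(1)] by simp
        then have "?R0 * A * ?R1\<^sup>T = ?R0 * ?y * T * (?z\<^sup>T * ?R1\<^sup>T)"
          using assoc_mult_mat[OF mult_carrier_mat[OF mult_carrier_mat[OF car(1,3)] car(5)] cT] by simp
        then show ?thesis
          using transpose_mult[OF car(2,4)] by (simp add: word_matrix_substitute len)
      qed
      have y0: "y0 \<in> echelon_words 0 m k" unfolding y0_def using y by (rule someI)
      have "c (?R0 * A * ?R1\<^sup>T) = C ?u ?v T"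
        using rank_word_product[OF u v T] by (simp add: B C_def)
      also have "\<dots> = c' T"
        unfolding c'_def by (rule \<phi>[OF C C mono[rule_format, OF y y0 z y0] T])
      also have "T = tau2 n k (?R0 * A * ?R1\<^sup>T)"
        unfolding B tau2_word_product[OF u v T] ..
      finally show ?thesis .
    qed
    moreover have "c' \<in> GL k \<rightarrow> {..<r}" using C by (simp add: c'_def)
    moreover have "?R0 \<in> rcef_mats n m" "?R1 \<in> rcef_mats n m"
      using R by (auto simp: rcef_mats_eq_echelon_words)
    ultimately show "\<exists>R0 \<in> rcef_mats n m. \<exists>R1 \<in> rcef_mats n m.
        \<exists>c' :: 'a mat \<Rightarrow> nat. c' \<in> GL k \<rightarrow> {..<r} \<and>
          (\<forall>B \<in> {R0 * A * transpose_mat R1 | A. A \<in> mats_of_rank m m k}.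
             c B = c' (tau2 n k B))" by blast
  qed
qed

end
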